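(* Let $A\,|\,B$ be a ring extension, with centralizer $R=C_A(B)$ and $T=(A\otimes_B A)^B$. Then $A\,|\,B$ is a separable extension if and only if the right module $R_T$ is finitely generated projective and $R\otimes_T(A\otimes_B A)\cong A$ as natural $A$-$A$-bimodules.
   Context: Rings are associative and unital. A ring extension $A\,|\,B$ is a unital ring homomorphism $B\to A$, making $A$ a $B$-bimodule. For a $B$-bimodule $M$, $M^B=\{m\in M: bm=mb\ \forall b\in B\}$. The centralizer is $R=C_A(B)=A^B$. Elements $t\in T=(A\otimes_B A)^B$ are written $t=t^1\otimes t^2$ with a possible summation suppressed. $T$ is a ring with unit $1\otimes 1$ and multiplication $tt'={t'}^1t^1\otimes t^2{t'}^2$. $R$ is a right $T$-module via $r\cdot t=t^1rt^2$. $A\otimes_B A$ is a left $T$-module via $t\cdot(a\otimes a')=at^1\otimes t^2a'$; this commutes with its usual (outer) $A$-$A$-bimodule structure, which gives $R\otimes_T(A\otimes_B A)$ its natural $A$-$A$-bimodule structure. The extension $A\,|\,B$ is separable if the multiplication map $\mu:A\otimes_B A\to A$, $a\otimes a'\mapsto aa'$, is a split epimorphism of $A$-$A$-bimodules. *)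

theory Defs
  imports "HOL-Algebra.Free_Abelian_Groups" "HOL-Algebra.RingHom"
begin

section \<open>Modules over noncommutative rings\<close>

text \<open>
  HOL-Algebra's \<open>module\<close> is restricted to commutative rings.  Here the underlying abelian group
  of a module is a \<open>monoid\<close> record written multiplicatively, like \<open>add_monoid\<close> of a ring,
  so that \<open>hom\<close>, \<open>Mod\<close>, \<open>finprod\<close>, \<open>free_Abelian_group\<close> and
  \<open>sum_group\<close> apply to it directly: \<open>mult\<close> is addition and \<open>one\<close> is zero.
\<close>

record ('r, 'm) lmod = "'m monoid" +
  lsmult :: "'r \<Rightarrow> 'm \<Rightarrow> 'm"

record ('r, 'm) rmod = "'m monoid" +
  rsmult :: "'m \<Rightarrow> 'r \<Rightarrow> 'm"

record ('a, 'm) bimod = "'m monoid" +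
  lbi :: "'a \<Rightarrow> 'm \<Rightarrow> 'm"
  rbi :: "'m \<Rightarrow> 'a \<Rightarrow> 'm"

definition lmod_of :: "('m, 'x) monoid_scheme \<Rightarrow> ('r \<Rightarrow> 'm \<Rightarrow> 'm) \<Rightarrow> ('r, 'm) lmod" where
  "lmod_of G l = \<lparr>carrier = carrier G, monoid.mult = monoid.mult G, one = one G, lsmult = l\<rparr>"

definition rmod_of :: "('m, 'x) monoid_scheme \<Rightarrow> ('m \<Rightarrow> 'r \<Rightarrow> 'm) \<Rightarrow> ('r, 'm) rmod" where
  "rmod_of G r = \<lparr>carrier = carrier G, monoid.mult = monoid.mult G, one = one G, rsmult = r\<rparr>"

definition bimod_of ::
  "('m, 'x) monoid_scheme \<Rightarrow> ('a \<Rightarrow> 'm \<Rightarrow> 'm) \<Rightarrow> ('m \<Rightarrow> 'a \<Rightarrow> 'm) \<Rightarrow> ('a, 'm) bimod" where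
  "bimod_of G l r =
     \<lparr>carrier = carrier G, monoid.mult = monoid.mult G, one = one G, lbi = l, rbi = r\<rparr>"

definition rmod_hom ::
  "('r, 'x) ring_scheme \<Rightarrow> ('r, 'm, 'y) rmod_scheme \<Rightarrow> ('r, 'n, 'z) rmod_scheme \<Rightarrow> ('m \<Rightarrow> 'n) set" where
  "rmod_hom S M N =
     {h \<in> hom M N. \<forall>m\<in>carrier M. \<forall>s\<in>carrier S. h (rsmult M m s) = rsmult N (h m) s}"

definition bimod_hom ::
  "('a, 'x) ring_scheme \<Rightarrow> ('a, 'm, 'y) bimod_scheme \<Rightarrow> ('a, 'n, 'z) bimod_scheme \<Rightarrow> ('m \<Rightarrow> 'n) set" where
  "bimod_hom A M N =
     {h \<in> hom M N. \<forall>m\<in>carrier M. \<forall>a\<in>carrier A.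
        h (lbi M a m) = lbi N a (h m) \<and> h (rbi M m a) = rbi N (h m) a}"

definition bimod_isomorphic ::
  "('a, 'x) ring_scheme \<Rightarrow> ('a, 'm, 'y) bimod_scheme \<Rightarrow> ('a, 'n, 'z) bimod_scheme \<Rightarrow> bool" where
  "bimod_isomorphic A M N \<longleftrightarrow> (\<exists>h\<in>bimod_hom A M N. bij_betw h (carrier M) (carrier N))"

definition bimod_split_epi ::
  "('a, 'x) ring_scheme \<Rightarrow> ('a, 'm, 'y) bimod_scheme \<Rightarrow> ('a, 'n, 'z) bimod_scheme \<Rightarrow> ('m \<Rightarrow> 'n) \<Rightarrow> bool"
  where
  "bimod_split_epi A M N h \<longleftrightarrow>
     h \<in> bimod_hom A M N \<and> (\<exists>s\<in>bimod_hom A N M. \<forall>n\<in>carrier N. h (s n) = n)"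

definition finitely_generated_rmod ::
  "('r, 'x) ring_scheme \<Rightarrow> ('r, 'm, 'y) rmod_scheme \<Rightarrow> bool" where
  "finitely_generated_rmod S M \<longleftrightarrow>
     (\<exists>X. finite X \<and> X \<subseteq> carrier M \<and>
        (\<forall>m\<in>carrier M. \<exists>c\<in>X \<rightarrow> carrier S. m = finprod M (\<lambda>x. rsmult M x (c x)) X))"

text \<open>
  The free right module on a set \<open>X\<close>: finitely supported functions from \<open>X\<close> to the ring.
\<close>

definition free_rmod :: "('r, 'x) ring_scheme \<Rightarrow> 'i set \<Rightarrow> ('r, 'i \<Rightarrow> 'r) rmod" where
  "free_rmod S X =
     rmod_of (sum_group X (\<lambda>_. add_monoid S)) (\<lambda>u s. \<lambda>x\<in>X. u x \<otimes>\<^bsub>S\<^esub> s)"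

text \<open>
  Projective means direct summand of a free module.  Taking the bases inside the type of elements
  of \<open>M\<close> is no restriction, since \<open>M\<close> is a quotient of the free module on
  \<open>carrier M\<close> and a projective module is a direct summand of every module that maps onto it.
\<close>

definition projective_rmod ::
  "('r, 'x) ring_scheme \<Rightarrow> ('r, 'm, 'y) rmod_scheme \<Rightarrow> bool" where
  "projective_rmod S M \<longleftrightarrow>
     (\<exists>X :: 'm set. \<exists>p\<in>rmod_hom S (free_rmod S X) M. \<exists>s\<in>rmod_hom S M (free_rmod S X).
        \<forall>m\<in>carrier M. p (s m) = m)"


section \<open>Tensor products\<close>

type_synonym ('m, 'n) tensor = "(('m \<times> 'n) \<Rightarrow>\<^sub>0 int) set"

definition tensor_relations ::
  "('r, 'x) ring_scheme \<Rightarrow> ('r, 'm, 'y) rmod_scheme \<Rightarrow> ('r, 'n, 'z) lmod_scheme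
     \<Rightarrow> (('m \<times> 'n) \<Rightarrow>\<^sub>0 int) set" where
  "tensor_relations S M N =
     {frag_of (m \<otimes>\<^bsub>M\<^esub> m', n) - frag_of (m, n) - frag_of (m', n) | m m' n.
        m \<in> carrier M \<and> m' \<in> carrier M \<and> n \<in> carrier N} \<union>
     {frag_of (m, n \<otimes>\<^bsub>N\<^esub> n') - frag_of (m, n) - frag_of (m, n') | m n n'.
        m \<in> carrier M \<and> n \<in> carrier N \<and> n' \<in> carrier N} \<union>
     {frag_of (rsmult M m s, n) - frag_of (m, lsmult N s n) | m s n.
        m \<in> carrier M \<and> s \<in> carrier S \<and> n \<in> carrier N}"

definition tensor_kernel ::
  "('r, 'x) ring_scheme \<Rightarrow> ('r, 'm, 'y) rmod_scheme \<Rightarrow> ('r, 'n, 'z) lmod_scheme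
     \<Rightarrow> (('m \<times> 'n) \<Rightarrow>\<^sub>0 int) set" where
  "tensor_kernel S M N =
     generate (free_Abelian_group (carrier M \<times> carrier N)) (tensor_relations S M N)"

definition tensor_product ::
  "('r, 'x) ring_scheme \<Rightarrow> ('r, 'm, 'y) rmod_scheme \<Rightarrow> ('r, 'n, 'z) lmod_scheme
     \<Rightarrow> ('m, 'n) tensor monoid" where
  "tensor_product S M N =
     free_Abelian_group (carrier M \<times> carrier N) Mod tensor_kernel S M N"

definition pure_tensor ::
  "('r, 'x) ring_scheme \<Rightarrow> ('r, 'm, 'y) rmod_scheme \<Rightarrow> ('r, 'n, 'z) lmod_scheme
     \<Rightarrow> 'm \<Rightarrow> 'n \<Rightarrow> ('m, 'n) tensor" where
  "pure_tensor S M N m n =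
     tensor_kernel S M N #>\<^bsub>free_Abelian_group (carrier M \<times> carrier N)\<^esub> frag_of (m, n)"

text \<open>
  The additive map out of a tensor product, with values in the abelian group \<open>P\<close>, that sends a
  pure tensor \<open>m \<otimes> n\<close> to \<open>\<phi> m n\<close>.  It makes sense for balanced \<open>\<phi>\<close>, since the
  formal sum defining it is then constant on cosets (lemma \<open>tensor_lift_pure\<close>).
\<close>

definition tensor_lift ::
  "('p, 'x) monoid_scheme \<Rightarrow> ('m \<Rightarrow> 'n \<Rightarrow> 'p) \<Rightarrow> ('m, 'n) tensor \<Rightarrow> 'p" where
  "tensor_lift P \<phi> X =
     the_elem ((\<lambda>c. finprod P (\<lambda>(m, n). \<phi> m n [^]\<^bsub>P\<^esub> Poly_Mapping.lookup c (m, n))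
                      (Poly_Mapping.keys c)) ` X)"

lemma (in comm_group) formal_sum_hom:
  assumes "f ` S \<subseteq> carrier G"
  shows "(\<lambda>c. finprod G (\<lambda>x. f x [^] Poly_Mapping.lookup c x) (Poly_Mapping.keys c))
           \<in> hom (free_Abelian_group S) G" (is "?h \<in> _")
    and "x \<in> S \<Longrightarrow> finprod G (\<lambda>y. f y [^] Poly_Mapping.lookup (frag_of x) y)
           (Poly_Mapping.keys (frag_of x)) = f x"
proof -
  have cl: "f x [^] (k::int) \<in> carrier G" if "x \<in> S" for x k
    using assms that by auto
  have ext: "?h c = finprod G (\<lambda>x. f x [^] Poly_Mapping.lookup c x) K"
    if "Poly_Mapping.keys c \<subseteq> K" "K \<subseteq> S" "finite K" for c K
  proof (rule finprod_mono_neutral_cong_left)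
    show "\<And>i. i \<in> K - Poly_Mapping.keys c \<Longrightarrow> f i [^] Poly_Mapping.lookup c i = \<one>"
      by (simp add: in_keys_iff)
    show "(\<lambda>x. f x [^] Poly_Mapping.lookup c x) \<in> K \<rightarrow> carrier G"
      using cl that(2) by blast
  qed (use that in auto)
  show "?h \<in> hom (free_Abelian_group S) G"
  proof (rule homI)
    fix c assume "c \<in> carrier (free_Abelian_group S)"
    then show "?h c \<in> carrier G"
      by (intro finprod_closed) (use cl in auto)
  next
    fix c d
    assume "c \<in> carrier (free_Abelian_group S)" "d \<in> carrier (free_Abelian_group S)"
    then have S: "Poly_Mapping.keys c \<subseteq> S" "Poly_Mapping.keys d \<subseteq> S"
      by auto
    let ?K = "Poly_Mapping.keys c \<union> Poly_Mapping.keys d"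
    have K: "?K \<subseteq> S" "finite ?K"
      using S by auto
    have fS: "f y \<in> carrier G" if "y \<in> ?K" for y
      using assms K that by blast
    have "?h (c + d) = finprod G (\<lambda>x. f x [^] Poly_Mapping.lookup (c + d) x) ?K"
      by (rule ext[OF keys_add K])
    also have "\<dots> = finprod G (\<lambda>x. f x [^] Poly_Mapping.lookup c x \<otimes> f x [^] Poly_Mapping.lookup d x) ?K"
      by (rule finprod_cong') (use fS in \<open>auto simp: lookup_add int_pow_mult\<close>)
    also have "\<dots> = finprod G (\<lambda>x. f x [^] Poly_Mapping.lookup c x) ?K
                     \<otimes> finprod G (\<lambda>x. f x [^] Poly_Mapping.lookup d x) ?K"
      by (rule finprod_multf) (use fS in auto)
    also have "\<dots> = ?h c \<otimes> ?h d"
      using ext[OF _ K, of c] ext[OF _ K, of d] by simp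
    finally show "?h (c \<otimes>\<^bsub>free_Abelian_group S\<^esub> d) = ?h c \<otimes> ?h d"
      by simp
  qed
  show "finprod G (\<lambda>y. f y [^] Poly_Mapping.lookup (frag_of x) y)
          (Poly_Mapping.keys (frag_of x)) = f x" if "x \<in> S"
  proof -
    have "f x \<in> carrier G" using assms that by blast
    then show ?thesis
      by (simp add: finprod_singleton)
  qed
qed

lemma tensor_lift_pure:
  assumes P: "comm_group P"
    and M: "\<And>m m'. m \<in> carrier M \<Longrightarrow> m' \<in> carrier M \<Longrightarrow> m \<otimes>\<^bsub>M\<^esub> m' \<in> carrier M"
      "\<And>m s. m \<in> carrier M \<Longrightarrow> s \<in> carrier S \<Longrightarrow> rsmult M m s \<in> carrier M"
    and N: "\<And>n n'. n \<in> carrier N \<Longrightarrow> n' \<in> carrier N \<Longrightarrow> n \<otimes>\<^bsub>N\<^esub> n' \<in> carrier N"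
      "\<And>n s. n \<in> carrier N \<Longrightarrow> s \<in> carrier S \<Longrightarrow> lsmult N s n \<in> carrier N"
    and \<phi>: "\<And>m n. m \<in> carrier M \<Longrightarrow> n \<in> carrier N \<Longrightarrow> \<phi> m n \<in> carrier P"
    and addl: "\<And>m m' n. m \<in> carrier M \<Longrightarrow> m' \<in> carrier M \<Longrightarrow> n \<in> carrier N
      \<Longrightarrow> \<phi> (m \<otimes>\<^bsub>M\<^esub> m') n = \<phi> m n \<otimes>\<^bsub>P\<^esub> \<phi> m' n"
    and addr: "\<And>m n n'. m \<in> carrier M \<Longrightarrow> n \<in> carrier N \<Longrightarrow> n' \<in> carrier N
      \<Longrightarrow> \<phi> m (n \<otimes>\<^bsub>N\<^esub> n') = \<phi> m n \<otimes>\<^bsub>P\<^esub> \<phi> m n'"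
    and bal: "\<And>m s n. m \<in> carrier M \<Longrightarrow> s \<in> carrier S \<Longrightarrow> n \<in> carrier N
      \<Longrightarrow> \<phi> (rsmult M m s) n = \<phi> m (lsmult N s n)"
  shows "tensor_lift P \<phi> \<in> hom (tensor_product S M N) P"
    and "m \<in> carrier M \<Longrightarrow> n \<in> carrier N \<Longrightarrow> tensor_lift P \<phi> (pure_tensor S M N m n) = \<phi> m n"
proof -
  interpret P: comm_group P by (rule P)
  let ?F = "free_Abelian_group (carrier M \<times> carrier N)"
  let ?K = "tensor_kernel S M N"
  define h where "h = (\<lambda>c :: _ \<Rightarrow>\<^sub>0 int. finprod P (\<lambda>(m, n). \<phi> m n [^]\<^bsub>P\<^esub> Poly_Mapping.lookup c (m, n))
                      (Poly_Mapping.keys c))"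
  have im: "(\<lambda>(m, n). \<phi> m n) ` (carrier M \<times> carrier N) \<subseteq> carrier P"
    using \<phi> by auto
  have h_eq: "h = (\<lambda>c. finprod P (\<lambda>x. (case x of (m, n) \<Rightarrow> \<phi> m n) [^]\<^bsub>P\<^esub> Poly_Mapping.lookup c x)
                      (Poly_Mapping.keys c))"
    by (simp add: h_def case_prod_unfold)
  have hom: "h \<in> hom ?F P"
    unfolding h_eq by (rule P.formal_sum_hom(1)[OF im])
  have frag: "h (frag_of (m, n)) = \<phi> m n" if "m \<in> carrier M" "n \<in> carrier N" for m n
    using P.formal_sum_hom(2)[OF im, of "(m, n)"] that by (simp add: h_eq)
  interpret F: comm_group ?F by (rule abelian_free_Abelian_group)
  interpret h: group_hom ?F P h
    by (simp add: hom group_hom_axioms_def group_hom_def)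
  have keys_diff3: "Poly_Mapping.keys (frag_of x - frag_of y - frag_of z) \<subseteq> carrier M \<times> carrier N"
    if "x \<in> carrier M \<times> carrier N" "y \<in> carrier M \<times> carrier N" "z \<in> carrier M \<times> carrier N" for x y z
    using that keys_diff[of "frag_of x - frag_of y" "frag_of z"] keys_diff[of "frag_of x" "frag_of y"]
    by auto
  have keys_diff2: "Poly_Mapping.keys (frag_of x - frag_of y) \<subseteq> carrier M \<times> carrier N"
    if "x \<in> carrier M \<times> carrier N" "y \<in> carrier M \<times> carrier N" for x y
    using that keys_diff[of "frag_of x" "frag_of y"] by auto
  have rel_sub: "tensor_relations S M N \<subseteq> carrier ?F"
    unfolding tensor_relations_def
    using keys_diff2 keys_diff3 M N by auto
  have h_diff: "h (c - d) = h c \<otimes>\<^bsub>P\<^esub> inv\<^bsub>P\<^esub> h d"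
    if "Poly_Mapping.keys c \<subseteq> carrier M \<times> carrier N" "Poly_Mapping.keys d \<subseteq> carrier M \<times> carrier N" for c d
    using that h.hom_mult[of c "- d"] h.hom_inv[of d] by simp
  have zero3: "h (frag_of x - frag_of y - frag_of z) = \<one>\<^bsub>P\<^esub>"
    if xyz: "x \<in> carrier M \<times> carrier N" "y \<in> carrier M \<times> carrier N" "z \<in> carrier M \<times> carrier N"
      and e: "h (frag_of x) = h (frag_of y) \<otimes>\<^bsub>P\<^esub> h (frag_of z)" for x y z
  proof -
    have c: "h (frag_of y) \<in> carrier P" "h (frag_of z) \<in> carrier P"
      using xyz by (auto intro!: h.hom_closed)
    have "h (frag_of x - frag_of y - frag_of z)
        = h (frag_of x) \<otimes>\<^bsub>P\<^esub> inv\<^bsub>P\<^esub> h (frag_of y) \<otimes>\<^bsub>P\<^esub> inv\<^bsub>P\<^esub> h (frag_of z)"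
      using xyz keys_diff2[of x y] by (subst h_diff; simp add: h_diff)
    also have "\<dots> = \<one>\<^bsub>P\<^esub>"
      using c e by (metis P.inv_closed P.inv_mult_group P.m_assoc P.m_comm P.m_closed P.r_inv)
    finally show ?thesis .
  qed
  have "h x = \<one>\<^bsub>P\<^esub>" if "x \<in> tensor_relations S M N" for x
  proof -
    from that consider
      (l) m m' n where "x = frag_of (m \<otimes>\<^bsub>M\<^esub> m', n) - frag_of (m, n) - frag_of (m', n)"
        "m \<in> carrier M" "m' \<in> carrier M" "n \<in> carrier N"
    | (r) m n n' where "x = frag_of (m, n \<otimes>\<^bsub>N\<^esub> n') - frag_of (m, n) - frag_of (m, n')"
        "m \<in> carrier M" "n \<in> carrier N" "n' \<in> carrier N"
    | (b) m s n where "x = frag_of (rsmult M m s, n) - frag_of (m, lsmult N s n)"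
        "m \<in> carrier M" "s \<in> carrier S" "n \<in> carrier N"
      unfolding tensor_relations_def by blast
    then show ?thesis
    proof cases
      case l
      then show ?thesis using M N by (auto intro!: zero3 simp: frag addl)
    next
      case r
      then show ?thesis using M N by (auto intro!: zero3 simp: frag addr)
    next
      case b
      then show ?thesis using M N by (simp add: h_diff frag bal \<phi>)
    qed
  qed
  then have rel_ker: "tensor_relations S M N \<subseteq> kernel ?F P h"
    using rel_sub unfolding kernel_def by blast
  have K_ker: "?K \<subseteq> kernel ?F P h"
    unfolding tensor_kernel_def
    using F.generate_subgroup_incl[OF rel_ker h.subgroup_kernel] .
  have K_sub: "subgroup ?K ?F"
    unfolding tensor_kernel_def using F.generate_is_subgroup[OF rel_sub] .
  have lift: "tensor_lift P \<phi> (?K #>\<^bsub>?F\<^esub> c) = h c" if "c \<in> carrier ?F" for c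
  proof -
    have "h ` (?K #>\<^bsub>?F\<^esub> c) = {h c}"
    proof (intro equalityI subsetI)
      fix y assume "y \<in> h ` (?K #>\<^bsub>?F\<^esub> c)"
      then obtain k where k: "k \<in> ?K" and y: "y = h (k \<otimes>\<^bsub>?F\<^esub> c)"
        unfolding r_coset_def by blast
      have "k \<in> carrier ?F" "h k = \<one>\<^bsub>P\<^esub>"
        using K_ker k unfolding kernel_def by auto
      then show "y \<in> {h c}"
        using that h.hom_mult[of k c] h.hom_closed[of c] y by simp
    next
      fix y assume "y \<in> {h c}"
      then show "y \<in> h ` (?K #>\<^bsub>?F\<^esub> c)"
        using F.rcos_self[OF that K_sub] by blast
    qed
    then show ?thesis
      unfolding tensor_lift_def h_def by simp
  qed
  have nor: "?K \<lhd> ?F"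
    using F.subgroup_imp_normal[OF K_sub] .
  show "tensor_lift P \<phi> \<in> hom (tensor_product S M N) P"
  proof (rule homI)
    fix X assume "X \<in> carrier (tensor_product S M N)"
    then obtain c where c: "c \<in> carrier ?F" "X = ?K #>\<^bsub>?F\<^esub> c"
      unfolding tensor_product_def FactGroup_def RCOSETS_def by auto
    then show "tensor_lift P \<phi> X \<in> carrier P"
      using lift h.hom_closed by simp
  next
    fix X Y assume "X \<in> carrier (tensor_product S M N)" "Y \<in> carrier (tensor_product S M N)"
    then obtain c d where c: "c \<in> carrier ?F" "X = ?K #>\<^bsub>?F\<^esub> c"
      and d: "d \<in> carrier ?F" "Y = ?K #>\<^bsub>?F\<^esub> d"
      unfolding tensor_product_def FactGroup_def RCOSETS_def by auto
    have "X \<otimes>\<^bsub>tensor_product S M N\<^esub> Y = ?K #>\<^bsub>?F\<^esub> (c \<otimes>\<^bsub>?F\<^esub> d)"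
      unfolding tensor_product_def FactGroup_def
      using normal.rcos_sum[OF nor c(1) d(1)] c d by simp
    moreover have "c \<otimes>\<^bsub>?F\<^esub> d \<in> carrier ?F"
      using c(1) d(1) by (rule F.m_closed)
    ultimately show "tensor_lift P \<phi> (X \<otimes>\<^bsub>tensor_product S M N\<^esub> Y)
        = tensor_lift P \<phi> X \<otimes>\<^bsub>P\<^esub> tensor_lift P \<phi> Y"
      using lift[OF c(1)] lift[OF d(1)] lift[of "c \<otimes>\<^bsub>?F\<^esub> d"] h.hom_mult[OF c(1) d(1)] c(2) d(2)
      by metis
  qed
  show "tensor_lift P \<phi> (pure_tensor S M N m n) = \<phi> m n" if "m \<in> carrier M" "n \<in> carrier N"
    using lift[of "frag_of (m, n)"] frag that by (simp add: pure_tensor_def)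
qed


section \<open>Ring extensions\<close>

text \<open>
  A ring extension \<open>A | B\<close> is given by rings \<open>A\<close>, \<open>B\<close> and a unital ring homomorphism
  \<open>f\<close> from \<open>B\<close> to \<open>A\<close>, i.e. by the locale predicate \<open>ring_hom_ring B A f\<close>.
\<close>

definition regular_bimod :: "('a, 'x) ring_scheme \<Rightarrow> ('a, 'a) bimod" where
  "regular_bimod A = bimod_of (add_monoid A) (monoid.mult A) (monoid.mult A)"

definition restricted_rmod :: "('a, 'x) ring_scheme \<Rightarrow> ('b \<Rightarrow> 'a) \<Rightarrow> ('b, 'a) rmod" where
  "restricted_rmod A f = rmod_of (add_monoid A) (\<lambda>a b. a \<otimes>\<^bsub>A\<^esub> f b)"

definition restricted_lmod :: "('a, 'x) ring_scheme \<Rightarrow> ('b \<Rightarrow> 'a) \<Rightarrow> ('b, 'a) lmod" where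
  "restricted_lmod A f = lmod_of (add_monoid A) (\<lambda>b a. f b \<otimes>\<^bsub>A\<^esub> a)"

abbreviation ext_pure ::
  "('a, 'x) ring_scheme \<Rightarrow> ('b, 'y) ring_scheme \<Rightarrow> ('b \<Rightarrow> 'a) \<Rightarrow> 'a \<Rightarrow> 'a \<Rightarrow> ('a, 'a) tensor" where
  "ext_pure A B f \<equiv> pure_tensor B (restricted_rmod A f) (restricted_lmod A f)"

text \<open>\<open>A \<otimes>\<^sub>B A\<close> with its outer bimodule structure.\<close>

definition ext_tensor ::
  "('a, 'x) ring_scheme \<Rightarrow> ('b, 'y) ring_scheme \<Rightarrow> ('b \<Rightarrow> 'a) \<Rightarrow> ('a, ('a, 'a) tensor) bimod" where
  "ext_tensor A B f =
     (let G = tensor_product B (restricted_rmod A f) (restricted_lmod A f)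
      in bimod_of G
           (\<lambda>a. tensor_lift G (\<lambda>x y. ext_pure A B f (a \<otimes>\<^bsub>A\<^esub> x) y))
           (\<lambda>t a. tensor_lift G (\<lambda>x y. ext_pure A B f x (y \<otimes>\<^bsub>A\<^esub> a)) t))"

definition ext_mult_map :: "('a, 'x) ring_scheme \<Rightarrow> ('a, 'a) tensor \<Rightarrow> 'a" where
  "ext_mult_map A = tensor_lift (add_monoid A) (\<lambda>x y. x \<otimes>\<^bsub>A\<^esub> y)"

definition separable_extension ::
  "('a, 'x) ring_scheme \<Rightarrow> ('b, 'y) ring_scheme \<Rightarrow> ('b \<Rightarrow> 'a) \<Rightarrow> bool" where
  "separable_extension A B f \<longleftrightarrow>
     bimod_split_epi A (ext_tensor A B f) (regular_bimod A) (ext_mult_map A)"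

text \<open>\<open>M\<^sup>B\<close>, where \<open>B\<close> acts on the \<open>A\<close>-bimodule \<open>M\<close> through \<open>f\<close>.\<close>

definition invariants ::
  "('b, 'y) ring_scheme \<Rightarrow> ('b \<Rightarrow> 'a) \<Rightarrow> ('a, 'm, 'z) bimod_scheme \<Rightarrow> 'm set" where
  "invariants B f M = {m \<in> carrier M. \<forall>b\<in>carrier B. lbi M (f b) m = rbi M m (f b)}"

definition ext_centralizer ::
  "('a, 'x) ring_scheme \<Rightarrow> ('b, 'y) ring_scheme \<Rightarrow> ('b \<Rightarrow> 'a) \<Rightarrow> 'a set" where
  "ext_centralizer A B f = invariants B f (regular_bimod A)"

text \<open>
  The action of \<open>t = t\<^sup>1 \<otimes> t\<^sup>2\<close> on \<open>A \<otimes>\<^sub>B A\<close> sends \<open>a \<otimes> a'\<close> to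
  \<open>a t\<^sup>1 \<otimes> t\<^sup>2 a'\<close>, which is \<open>t\<close> multiplied by \<open>a\<close> and \<open>a'\<close> on the outside.
\<close>

definition ext_act ::
  "('a, 'x) ring_scheme \<Rightarrow> ('b, 'y) ring_scheme \<Rightarrow> ('b \<Rightarrow> 'a)
     \<Rightarrow> ('a, 'a) tensor \<Rightarrow> ('a, 'a) tensor \<Rightarrow> ('a, 'a) tensor" where
  "ext_act A B f t =
     (let Q = ext_tensor A B f in tensor_lift Q (\<lambda>a a'. rbi Q (lbi Q a t) a'))"

text \<open>
  The ring \<open>T = (A \<otimes>\<^sub>B A)\<^sup>B\<close>.  Its product \<open>t t' = t'\<^sup>1 t\<^sup>1 \<otimes> t\<^sup>2 t'\<^sup>2\<close> is the
  value of the action of \<open>t\<close> at \<open>t' = t'\<^sup>1 \<otimes> t'\<^sup>2\<close>.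
\<close>

definition ext_T ::
  "('a, 'x) ring_scheme \<Rightarrow> ('b, 'y) ring_scheme \<Rightarrow> ('b \<Rightarrow> 'a) \<Rightarrow> ('a, 'a) tensor ring" where
  "ext_T A B f =
     (let Q = ext_tensor A B f
      in \<lparr>carrier = invariants B f Q,
          monoid.mult = ext_act A B f,
          one = ext_pure A B f \<one>\<^bsub>A\<^esub> \<one>\<^bsub>A\<^esub>,
          zero = one Q,
          add = monoid.mult Q\<rparr>)"

text \<open>\<open>R\<close> as a right \<open>T\<close>-module, with action \<open>r \<cdot> t = t\<^sup>1 r t\<^sup>2\<close>.\<close>

definition ext_R_T ::
  "('a, 'x) ring_scheme \<Rightarrow> ('b, 'y) ring_scheme \<Rightarrow> ('b \<Rightarrow> 'a) \<Rightarrow> (('a, 'a) tensor, 'a) rmod" where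
  "ext_R_T A B f =
     rmod_of ((add_monoid A)\<lparr>carrier := ext_centralizer A B f\<rparr>)
       (\<lambda>r. tensor_lift (add_monoid A) (\<lambda>x y. x \<otimes>\<^bsub>A\<^esub> r \<otimes>\<^bsub>A\<^esub> y))"

definition ext_T_tensor ::
  "('a, 'x) ring_scheme \<Rightarrow> ('b, 'y) ring_scheme \<Rightarrow> ('b \<Rightarrow> 'a)
     \<Rightarrow> (('a, 'a) tensor, ('a, 'a) tensor) lmod" where
  "ext_T_tensor A B f = lmod_of (ext_tensor A B f) (ext_act A B f)"

text \<open>
  \<open>R \<otimes>\<^sub>T (A \<otimes>\<^sub>B A)\<close> with the bimodule structure induced by the outer one on the second factor.
\<close>

definition ext_R_tensor ::
  "('a, 'x) ring_scheme \<Rightarrow> ('b, 'y) ring_scheme \<Rightarrow> ('b \<Rightarrow> 'a)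
     \<Rightarrow> ('a, ('a, ('a, 'a) tensor) tensor) bimod" where
  "ext_R_tensor A B f =
     (let Q = ext_tensor A B f;
          G = tensor_product (ext_T A B f) (ext_R_T A B f) (ext_T_tensor A B f);
          pure = pure_tensor (ext_T A B f) (ext_R_T A B f) (ext_T_tensor A B f)
      in bimod_of G
           (\<lambda>a. tensor_lift G (\<lambda>r q. pure r (lbi Q a q)))
           (\<lambda>z a. tensor_lift G (\<lambda>r q. pure r (rbi Q q a)) z))"

end

theory Submission
  imports Defs
begin

text \<open>
  If \<open>e\<close> is a separability element, i.e. \<open>a e = e a\<close> for all \<open>a\<close> and \<open>e\<^sup>1 e\<^sup>2 = 1\<close>, then
  \<open>r \<mapsto> r e\<close> splits the map \<open>t \<mapsto> 1 \<cdot> t\<close> from \<open>T\<close> onto \<open>R\<close>, and \<open>a \<mapsto> 1 \<otimes> a e\<close> is inverse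
  to \<open>r \<otimes> (a \<otimes> a') \<mapsto> a r a'\<close>.  Conversely, let \<open>h\<close> be an isomorphism from
  \<open>R \<otimes>\<^sub>T (A \<otimes>\<^sub>B A)\<close> to \<open>A\<close> and put \<open>z = h\<^sup>-\<^sup>1(1)\<close>, which is central.  A dual basis of \<open>R\<close> writes \<open>z\<close> as
  a finite sum of elements \<open>\<rho> \<otimes> q\<close> with \<open>q\<close> central in \<open>A \<otimes>\<^sub>B A\<close>, and each \<open>h (\<rho> \<otimes> q)\<close> is the product
  \<open>e\<^sup>1 e\<^sup>2\<close> of another central element; the sum of these is a separability element.
\<close>

section \<open>Tensor products\<close>

text \<open>The records for \<open>A\<close>, for \<open>A \<otimes>\<^sub>B A\<close> and for the
  tensor product over \<open>T\<close> copy the group fields of an existing group and add scalar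
  actions, so their group axioms are imported field by field.\<close>

lemma comm_group_cong:
  assumes "comm_group G" and "carrier H = carrier G"
    and "monoid.mult H = monoid.mult G" and "one H = one G"
  shows "comm_group H"
proof -
  interpret G: comm_group G by (rule assms(1))
  show ?thesis
  proof (rule comm_groupI)
    show "\<exists>y\<in>carrier H. y \<otimes>\<^bsub>H\<^esub> x = \<one>\<^bsub>H\<^esub>" if "x \<in> carrier H" for x
      using that G.l_inv_ex by (simp add: assms)
  qed (simp_all add: assms G.m_ac)
qed

lemma comm_group_hom:
  assumes "comm_group G" "comm_group H" "h \<in> hom G H"
  shows "h \<one>\<^bsub>G\<^esub> = \<one>\<^bsub>H\<^esub>" and "x \<in> carrier G \<Longrightarrow> h (inv\<^bsub>G\<^esub> x) = inv\<^bsub>H\<^esub> h x"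
proof -
  interpret group_hom G H h
    using assms by (simp add: group_hom_def group_hom_axioms_def comm_group_def)
  show "h \<one>\<^bsub>G\<^esub> = \<one>\<^bsub>H\<^esub>" and "x \<in> carrier G \<Longrightarrow> h (inv\<^bsub>G\<^esub> x) = inv\<^bsub>H\<^esub> h x"
    by simp_all
qed

text \<open>Balancing is imposed by the relations, so the construction rests on two abelian groups
  with closed scalar actions. The locale is instantiated twice, over \<open>B\<close> and over
  \<open>T\<close>.\<close>

locale tensor_factors = M: comm_group M + N: comm_group N
  for M :: "('r, 'm, 'y) rmod_scheme" and N :: "('r, 'n, 'z) lmod_scheme" +
  fixes S :: "('r, 'x) ring_scheme"
  assumes rsmult_closed: "m \<in> carrier M \<Longrightarrow> s \<in> carrier S \<Longrightarrow> rsmult M m s \<in> carrier M"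
    and lsmult_closed: "n \<in> carrier N \<Longrightarrow> s \<in> carrier S \<Longrightarrow> lsmult N s n \<in> carrier N"
begin

abbreviation "F \<equiv> free_Abelian_group (carrier M \<times> carrier N)"
abbreviation "K \<equiv> tensor_kernel S M N"
abbreviation "P \<equiv> tensor_product S M N"
abbreviation "pure \<equiv> pure_tensor S M N"

sublocale F: comm_group F
  by (rule abelian_free_Abelian_group)

lemma tensor_relations_subset: "tensor_relations S M N \<subseteq> carrier F"
proof -
  have 2: "Poly_Mapping.keys (frag_of x - frag_of y) \<subseteq> carrier M \<times> carrier N"
    if "x \<in> carrier M \<times> carrier N" "y \<in> carrier M \<times> carrier N" for x y
    using that keys_diff[of "frag_of x" "frag_of y"] by auto
  have 3: "Poly_Mapping.keys (frag_of x - frag_of y - frag_of z) \<subseteq> carrier M \<times> carrier N"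
    if "x \<in> carrier M \<times> carrier N" "y \<in> carrier M \<times> carrier N" "z \<in> carrier M \<times> carrier N"
    for x y z
    using that 2[of x y] keys_diff[of "frag_of x - frag_of y" "frag_of z"] by auto
  show ?thesis
    unfolding tensor_relations_def using 2 3 rsmult_closed lsmult_closed by auto
qed

lemma tensor_kernel_subgroup: "subgroup K F"
  unfolding tensor_kernel_def by (rule F.generate_is_subgroup[OF tensor_relations_subset])

lemma tensor_kernel_normal: "K \<lhd> F"
  by (rule F.subgroup_imp_normal[OF tensor_kernel_subgroup])

lemma tensor_comm_group: "comm_group P"
  unfolding tensor_product_def
  by (rule F.abelian_FactGroup[OF tensor_kernel_subgroup])

sublocale P: comm_group P
  by (rule tensor_comm_group)

lemma coset_closed: "c \<in> carrier F \<Longrightarrow> K #>\<^bsub>F\<^esub> c \<in> carrier P"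
  unfolding tensor_product_def FactGroup_def RCOSETS_def by auto

lemma coset_mult:
  "c \<in> carrier F \<Longrightarrow> d \<in> carrier F
    \<Longrightarrow> (K #>\<^bsub>F\<^esub> c) \<otimes>\<^bsub>P\<^esub> (K #>\<^bsub>F\<^esub> d) = K #>\<^bsub>F\<^esub> (c + d)"
  using normal.rcos_sum[OF tensor_kernel_normal, of c d]
  by (simp add: tensor_product_def FactGroup_def)

lemma coset_eqI:
  assumes "c \<in> carrier F" "d \<in> carrier F" "c - d \<in> K"
  shows "K #>\<^bsub>F\<^esub> c = K #>\<^bsub>F\<^esub> d"
proof -
  have "c \<in> K #>\<^bsub>F\<^esub> d"
    unfolding r_coset_def using assms(3) by force
  then show ?thesis
    using F.repr_independence[OF _ assms(2) tensor_kernel_subgroup] by simp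
qed

lemma tensor_relation_in_kernel: "c \<in> tensor_relations S M N \<Longrightarrow> c \<in> K"
  unfolding tensor_kernel_def by (rule generate.incl)

lemma pure_closed [simp]: "m \<in> carrier M \<Longrightarrow> n \<in> carrier N \<Longrightarrow> pure m n \<in> carrier P"
  unfolding pure_tensor_def by (rule coset_closed) simp

lemma pure_addl:
  assumes "m \<in> carrier M" "m' \<in> carrier M" "n \<in> carrier N"
  shows "pure (m \<otimes>\<^bsub>M\<^esub> m') n = pure m n \<otimes>\<^bsub>P\<^esub> pure m' n"
proof -
  \<comment> \<open>The relation has the shape \<open>x - y - z\<close>; regrouped as
    \<open>x - (y + z)\<close> it is a difference of two coset representatives, as
    \<open>coset_eqI\<close> wants.\<close>
  let ?s = "frag_of (m, n) + frag_of (m', n)"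
  have "frag_of (m \<otimes>\<^bsub>M\<^esub> m', n) - ?s \<in> tensor_relations S M N"
    unfolding tensor_relations_def diff_diff_eq[symmetric] using assms by blast
  moreover have "Poly_Mapping.keys ?s \<subseteq> carrier M \<times> carrier N"
    using assms keys_add[of "frag_of (m, n)" "frag_of (m', n)"] by auto
  ultimately have "K #>\<^bsub>F\<^esub> frag_of (m \<otimes>\<^bsub>M\<^esub> m', n) = K #>\<^bsub>F\<^esub> ?s"
    using assms by (intro coset_eqI tensor_relation_in_kernel) simp_all
  then show ?thesis
    unfolding pure_tensor_def using assms by (simp add: coset_mult)
qed

lemma pure_addr:
  assumes "m \<in> carrier M" "n \<in> carrier N" "n' \<in> carrier N"
  shows "pure m (n \<otimes>\<^bsub>N\<^esub> n') = pure m n \<otimes>\<^bsub>P\<^esub> pure m n'"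
proof -
  let ?s = "frag_of (m, n) + frag_of (m, n')"
  have "frag_of (m, n \<otimes>\<^bsub>N\<^esub> n') - ?s \<in> tensor_relations S M N"
    unfolding tensor_relations_def diff_diff_eq[symmetric] using assms by blast
  moreover have "Poly_Mapping.keys ?s \<subseteq> carrier M \<times> carrier N"
    using assms keys_add[of "frag_of (m, n)" "frag_of (m, n')"] by auto
  ultimately have "K #>\<^bsub>F\<^esub> frag_of (m, n \<otimes>\<^bsub>N\<^esub> n') = K #>\<^bsub>F\<^esub> ?s"
    using assms by (intro coset_eqI tensor_relation_in_kernel) simp_all
  then show ?thesis
    unfolding pure_tensor_def using assms by (simp add: coset_mult)
qed

lemma pure_balanced:
  assumes "m \<in> carrier M" "s \<in> carrier S" "n \<in> carrier N"
  shows "pure (rsmult M m s) n = pure m (lsmult N s n)"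
proof -
  have "frag_of (rsmult M m s, n) - frag_of (m, lsmult N s n) \<in> tensor_relations S M N"
    unfolding tensor_relations_def using assms by blast
  then show ?thesis
    unfolding pure_tensor_def using assms rsmult_closed lsmult_closed
    by (intro coset_eqI tensor_relation_in_kernel) simp_all
qed

lemma pure_homl: "n \<in> carrier N \<Longrightarrow> (\<lambda>m. pure m n) \<in> hom M P"
  by (rule homI) (simp_all add: pure_addl)

text \<open>Sums of pure tensors are enough because zero is the pure tensor of two zeros, and a pure
  tensor is negated by negating its first factor.\<close>

lemma tensor_induct [consumes 1, case_names pure mult]:
  assumes X: "X \<in> carrier P"
    and pure: "\<And>m n. m \<in> carrier M \<Longrightarrow> n \<in> carrier N \<Longrightarrow> Q (pure m n)"
    and mult: "\<And>X Y. X \<in> carrier P \<Longrightarrow> Y \<in> carrier P \<Longrightarrow> Q X \<Longrightarrow> Q Y \<Longrightarrow> Q (X \<otimes>\<^bsub>P\<^esub> Y)"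
  shows "Q X"
proof -
  have one: "Q \<one>\<^bsub>P\<^esub>"
    using pure[OF M.one_closed N.one_closed]
      comm_group_hom(1)[OF M.comm_group_axioms P.comm_group_axioms pure_homl, of "\<one>\<^bsub>N\<^esub>"]
    by simp
  have inv: "Q (inv\<^bsub>P\<^esub> (pure m n))" if "m \<in> carrier M" "n \<in> carrier N" for m n
    using pure[of "inv\<^bsub>M\<^esub> m" n] that
      comm_group_hom(2)[OF M.comm_group_axioms P.comm_group_axioms pure_homl]
    by simp
  \<comment> \<open>The negative of the coset is carried along because \<open>a - b\<close> needs
    \<open>Q\<close> at the negative of \<open>b\<close>; the support condition is carried along
    because the \<open>diff\<close> case of \<open>frag_induction\<close> provides only the
    induction predicate.\<close>
  have "Poly_Mapping.keys c \<subseteq> carrier M \<times> carrier N \<and>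
      Q (K #>\<^bsub>F\<^esub> c) \<and> Q (inv\<^bsub>P\<^esub> (K #>\<^bsub>F\<^esub> c))"
    if "Poly_Mapping.keys c \<subseteq> carrier M \<times> carrier N" for c
    using that
  proof (induction c rule: frag_induction)
    case zero
    have "K #>\<^bsub>F\<^esub> 0 = \<one>\<^bsub>P\<^esub>"
      using F.coset_mult_one[of K] subgroup.subset[OF tensor_kernel_subgroup]
      by (simp add: tensor_product_def FactGroup_def)
    then show ?case using one by simp
  next
    case (one x)
    then show ?case
      using pure inv by (cases x) (auto simp: pure_tensor_def)
  next
    case (diff a b)
    let ?a = "K #>\<^bsub>F\<^esub> a" and ?b = "K #>\<^bsub>F\<^esub> b"
    have ab: "?a \<in> carrier P" "?b \<in> carrier P"
      using diff coset_closed by auto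
    have k: "Poly_Mapping.keys (a - b) \<subseteq> carrier M \<times> carrier N"
      using diff keys_diff[of a b] by auto
    have "(K #>\<^bsub>F\<^esub> (a - b)) \<otimes>\<^bsub>P\<^esub> ?b = ?a"
      using diff k by (subst coset_mult) auto
    then have "K #>\<^bsub>F\<^esub> (a - b) = ?a \<otimes>\<^bsub>P\<^esub> inv\<^bsub>P\<^esub> ?b"
      using ab k coset_closed by (metis P.inv_solve_right carrier_free_Abelian_group_iff)
    moreover from this have "inv\<^bsub>P\<^esub> (K #>\<^bsub>F\<^esub> (a - b)) = inv\<^bsub>P\<^esub> ?a \<otimes>\<^bsub>P\<^esub> ?b"
      using ab by (simp add: P.inv_mult)
    ultimately show ?case
      using diff ab k by (auto intro: mult)
  qed
  moreover obtain c where "c \<in> carrier F" "X = K #>\<^bsub>F\<^esub> c"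
    using X unfolding tensor_product_def FactGroup_def RCOSETS_def by auto
  ultimately show ?thesis by auto
qed

lemma tensor_lift:
  assumes "comm_group G"
    and "\<And>m n. m \<in> carrier M \<Longrightarrow> n \<in> carrier N \<Longrightarrow> \<phi> m n \<in> carrier G"
    and "\<And>m m' n. m \<in> carrier M \<Longrightarrow> m' \<in> carrier M \<Longrightarrow> n \<in> carrier N
      \<Longrightarrow> \<phi> (m \<otimes>\<^bsub>M\<^esub> m') n = \<phi> m n \<otimes>\<^bsub>G\<^esub> \<phi> m' n"
    and "\<And>m n n'. m \<in> carrier M \<Longrightarrow> n \<in> carrier N \<Longrightarrow> n' \<in> carrier N
      \<Longrightarrow> \<phi> m (n \<otimes>\<^bsub>N\<^esub> n') = \<phi> m n \<otimes>\<^bsub>G\<^esub> \<phi> m n'"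
    and "\<And>m s n. m \<in> carrier M \<Longrightarrow> s \<in> carrier S \<Longrightarrow> n \<in> carrier N
      \<Longrightarrow> \<phi> (rsmult M m s) n = \<phi> m (lsmult N s n)"
  shows "tensor_lift G \<phi> \<in> hom P G"
    and "m \<in> carrier M \<Longrightarrow> n \<in> carrier N \<Longrightarrow> tensor_lift G \<phi> (pure m n) = \<phi> m n"
proof -
  note lift = tensor_lift_pure[OF assms(1) M.m_closed rsmult_closed N.m_closed lsmult_closed
      assms(2-5)]
  show "tensor_lift G \<phi> \<in> hom P G" by (rule lift(1))
  show "m \<in> carrier M \<Longrightarrow> n \<in> carrier N \<Longrightarrow> tensor_lift G \<phi> (pure m n) = \<phi> m n"
    by (rule lift(2))
qed

end

section \<open>The tensor square of a ring extension\<close>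

locale ring_extension = ring_hom_ring B A f
  for A :: "('a, 'x) ring_scheme" (structure) and B :: "('b, 'y) ring_scheme" and f :: "'b \<Rightarrow> 'a"
begin

abbreviation Q where "Q \<equiv> ext_tensor A B f"
abbreviation T where "T \<equiv> ext_T A B f"
abbreviation R where "R \<equiv> ext_R_T A B f"
abbreviation act where "act \<equiv> ext_act A B f"
abbreviation pure (infixl "\<boxtimes>" 75) where "pure \<equiv> ext_pure A B f"
text \<open>The action of \<open>T\<close> on \<open>R\<close> makes sense on all of
  \<open>A \<otimes>\<^sub>B A\<close>: \<open>ev r\<close> sends \<open>a \<boxtimes> b\<close> to
  \<open>a \<otimes> r \<otimes> b\<close>, and \<open>ev \<one>\<close> is the multiplication
  map.\<close>

abbreviation ev where "ev \<equiv> rsmult R"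

lemma add_comm_group: "comm_group (add_monoid A)"
  by (rule S.a_comm_group)

sublocale TQ: tensor_factors "restricted_rmod A f" "restricted_lmod A f" B
proof -
  have "comm_group (restricted_rmod A f)" "comm_group (restricted_lmod A f)"
    by (rule comm_group_cong[OF add_comm_group];
        simp add: restricted_rmod_def restricted_lmod_def rmod_of_def lmod_of_def)+
  then show "tensor_factors (restricted_rmod A f) (restricted_lmod A f) B"
    by (simp add: tensor_factors_def tensor_factors_axioms_def
        restricted_rmod_def restricted_lmod_def rmod_of_def lmod_of_def)
qed

lemma restricted_simps:
  "carrier (restricted_rmod A f) = carrier A"
  "carrier (restricted_lmod A f) = carrier A"
  "monoid.mult (restricted_rmod A f) = add A"
  "monoid.mult (restricted_lmod A f) = add A"
  "rsmult (restricted_rmod A f) a b = a \<otimes> f b"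
  "lsmult (restricted_lmod A f) b a = f b \<otimes> a"
  by (simp_all add: restricted_rmod_def restricted_lmod_def rmod_of_def lmod_of_def)

lemma Q_simps:
  "carrier Q = carrier TQ.P" "monoid.mult Q = monoid.mult TQ.P" "one Q = one TQ.P"
  by (simp_all add: ext_tensor_def Let_def bimod_of_def)

lemma Q_hom: "hom Q G = hom TQ.P G" "hom G Q = hom G TQ.P"
  by (simp_all add: hom_def Q_simps)

lemma Q_comm_group: "comm_group Q"
  by (rule comm_group_cong[OF TQ.tensor_comm_group]) (simp_all add: Q_simps)

sublocale Q: comm_group Q
  by (rule Q_comm_group)

lemma pure_closed [simp]: "a \<in> carrier A \<Longrightarrow> b \<in> carrier A \<Longrightarrow> a \<boxtimes> b \<in> carrier Q"
  using TQ.pure_closed by (simp add: restricted_simps Q_simps)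

lemma pure_addl:
  "a \<in> carrier A \<Longrightarrow> a' \<in> carrier A \<Longrightarrow> b \<in> carrier A
    \<Longrightarrow> (a \<oplus> a') \<boxtimes> b = (a \<boxtimes> b) \<otimes>\<^bsub>Q\<^esub> (a' \<boxtimes> b)"
  using TQ.pure_addl by (simp add: restricted_simps Q_simps)

lemma pure_addr:
  "a \<in> carrier A \<Longrightarrow> b \<in> carrier A \<Longrightarrow> b' \<in> carrier A
    \<Longrightarrow> a \<boxtimes> (b \<oplus> b') = (a \<boxtimes> b) \<otimes>\<^bsub>Q\<^esub> (a \<boxtimes> b')"
  using TQ.pure_addr by (simp add: restricted_simps Q_simps)

lemma pure_balanced:
  "a \<in> carrier A \<Longrightarrow> s \<in> carrier B \<Longrightarrow> b \<in> carrier A \<Longrightarrow> (a \<otimes> f s) \<boxtimes> b = a \<boxtimes> (f s \<otimes> b)"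
  using TQ.pure_balanced by (simp add: restricted_simps)

text \<open>Most identities below are additive in an element of \<open>Q\<close> and are therefore
  checked on pure tensors, through this rule.\<close>

lemma Q_induct [consumes 1, case_names pure mult]:
  assumes "q \<in> carrier Q"
    and "\<And>a b. a \<in> carrier A \<Longrightarrow> b \<in> carrier A \<Longrightarrow> \<Phi> (a \<boxtimes> b)"
    and "\<And>q q'. q \<in> carrier Q \<Longrightarrow> q' \<in> carrier Q \<Longrightarrow> \<Phi> q \<Longrightarrow> \<Phi> q' \<Longrightarrow> \<Phi> (q \<otimes>\<^bsub>Q\<^esub> q')"
  shows "\<Phi> q"
  using TQ.tensor_induct[of q \<Phi>] assms by (simp add: restricted_simps Q_simps)

lemma Q_lift:
  assumes "comm_group G"
    and "\<And>a b. a \<in> carrier A \<Longrightarrow> b \<in> carrier A \<Longrightarrow> \<phi> a b \<in> carrier G"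
    and "\<And>a a' b. a \<in> carrier A \<Longrightarrow> a' \<in> carrier A \<Longrightarrow> b \<in> carrier A
      \<Longrightarrow> \<phi> (a \<oplus> a') b = \<phi> a b \<otimes>\<^bsub>G\<^esub> \<phi> a' b"
    and "\<And>a b b'. a \<in> carrier A \<Longrightarrow> b \<in> carrier A \<Longrightarrow> b' \<in> carrier A
      \<Longrightarrow> \<phi> a (b \<oplus> b') = \<phi> a b \<otimes>\<^bsub>G\<^esub> \<phi> a b'"
    and "\<And>a s b. a \<in> carrier A \<Longrightarrow> s \<in> carrier B \<Longrightarrow> b \<in> carrier A
      \<Longrightarrow> \<phi> (a \<otimes> f s) b = \<phi> a (f s \<otimes> b)"
  shows "tensor_lift G \<phi> \<in> hom Q G"
    and "a \<in> carrier A \<Longrightarrow> b \<in> carrier A \<Longrightarrow> tensor_lift G \<phi> (a \<boxtimes> b) = \<phi> a b"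
  using TQ.tensor_lift[OF assms(1), of \<phi>] assms(2-5)
  by (simp_all add: restricted_simps Q_hom)

section \<open>The outer bimodule structure of \<open>A \<otimes>\<^sub>B A\<close>\<close>

lemma lbi_Q:
  assumes a: "a \<in> carrier A"
  shows lbi_hom: "lbi Q a \<in> hom Q Q"
    and lbi_pure [simp]: "x \<in> carrier A \<Longrightarrow> y \<in> carrier A \<Longrightarrow> lbi Q a (x \<boxtimes> y) = (a \<otimes> x) \<boxtimes> y"
proof -
  \<comment> \<open>\<open>ext_tensor\<close> lifts into the bare group \<open>TQ.P\<close>, since
    its own record is still being built there; \<open>Q_hom\<close> identifies homomorphisms into
    the two.\<close>
  have eq: "lbi Q a = tensor_lift TQ.P (\<lambda>x y. (a \<otimes> x) \<boxtimes> y)"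
    by (simp add: ext_tensor_def Let_def bimod_of_def)
  show "lbi Q a \<in> hom Q Q"
    "x \<in> carrier A \<Longrightarrow> y \<in> carrier A \<Longrightarrow> lbi Q a (x \<boxtimes> y) = (a \<otimes> x) \<boxtimes> y"
    unfolding eq Q_hom(2) using a
    by (intro Q_lift TQ.tensor_comm_group;
        simp add: S.r_distr pure_addl pure_addr pure_balanced S.m_assoc[symmetric]
          flip: Q_simps)+
qed

lemma rbi_Q:
  assumes a: "a \<in> carrier A"
  shows rbi_hom: "(\<lambda>q. rbi Q q a) \<in> hom Q Q"
    and rbi_pure [simp]: "x \<in> carrier A \<Longrightarrow> y \<in> carrier A \<Longrightarrow> rbi Q (x \<boxtimes> y) a = x \<boxtimes> (y \<otimes> a)"
proof -
  have eq: "rbi Q q a = tensor_lift TQ.P (\<lambda>x y. x \<boxtimes> (y \<otimes> a)) q" for q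
    by (simp add: ext_tensor_def Let_def bimod_of_def)
  show "(\<lambda>q. rbi Q q a) \<in> hom Q Q"
    "x \<in> carrier A \<Longrightarrow> y \<in> carrier A \<Longrightarrow> rbi Q (x \<boxtimes> y) a = x \<boxtimes> (y \<otimes> a)"
    unfolding eq Q_hom(2) using a
    by (intro Q_lift TQ.tensor_comm_group;
        simp add: S.l_distr pure_addl pure_addr pure_balanced S.m_assoc
          flip: Q_simps)+
qed

lemma bimod_closed [simp]:
  assumes "a \<in> carrier A" "q \<in> carrier Q"
  shows "lbi Q a q \<in> carrier Q" "rbi Q q a \<in> carrier Q"
  using hom_in_carrier[OF lbi_hom] hom_in_carrier[OF rbi_hom] assms by auto

lemma bimod_mult [simp]:
  assumes "a \<in> carrier A" "q \<in> carrier Q" "q' \<in> carrier Q"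
  shows "lbi Q a (q \<otimes>\<^bsub>Q\<^esub> q') = lbi Q a q \<otimes>\<^bsub>Q\<^esub> lbi Q a q'"
    and "rbi Q (q \<otimes>\<^bsub>Q\<^esub> q') a = rbi Q q a \<otimes>\<^bsub>Q\<^esub> rbi Q q' a"
  using Group.hom_mult[OF lbi_hom] Group.hom_mult[OF rbi_hom] assms by auto

lemma bimod_assoc:
  assumes "a \<in> carrier A" "b \<in> carrier A" "q \<in> carrier Q"
  shows lbi_lbi: "lbi Q a (lbi Q b q) = lbi Q (a \<otimes> b) q"
    and rbi_rbi: "rbi Q (rbi Q q a) b = rbi Q q (a \<otimes> b)"
    and lbi_rbi: "rbi Q (lbi Q a q) b = lbi Q a (rbi Q q b)"
  using assms(3) by (induction q rule: Q_induct; simp add: assms S.m_assoc)+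

lemma bimod_one [simp]:
  assumes "q \<in> carrier Q"
  shows "lbi Q \<one> q = q" and "rbi Q q \<one> = q"
  using assms by (induction q rule: Q_induct; simp)+

text \<open>When additivity in a scalar is proved by induction over sums in \<open>Q\<close>, the
  two sides group the same four summands differently; this regroups them.\<close>

lemma Q_interchange:
  assumes "p \<in> carrier Q" "q \<in> carrier Q" "p' \<in> carrier Q" "q' \<in> carrier Q"
  shows "(p \<otimes>\<^bsub>Q\<^esub> q) \<otimes>\<^bsub>Q\<^esub> (p' \<otimes>\<^bsub>Q\<^esub> q') = (p \<otimes>\<^bsub>Q\<^esub> p') \<otimes>\<^bsub>Q\<^esub> (q \<otimes>\<^bsub>Q\<^esub> q')"
  using assms by (metis Q.m_assoc Q.m_closed Q.m_comm)

lemma A_interchange: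
  assumes "p \<in> carrier A" "q \<in> carrier A" "p' \<in> carrier A" "q' \<in> carrier A"
  shows "(p \<oplus> q) \<oplus> (p' \<oplus> q') = (p \<oplus> p') \<oplus> (q \<oplus> q')"
  using assms by (simp add: S.a_ac)

lemma bimod_add:
  assumes "a \<in> carrier A" "b \<in> carrier A" "q \<in> carrier Q"
  shows lbi_add: "lbi Q (a \<oplus> b) q = lbi Q a q \<otimes>\<^bsub>Q\<^esub> lbi Q b q"
    and rbi_add: "rbi Q q (a \<oplus> b) = rbi Q q a \<otimes>\<^bsub>Q\<^esub> rbi Q q b"
proof -
  show "lbi Q (a \<oplus> b) q = lbi Q a q \<otimes>\<^bsub>Q\<^esub> lbi Q b q"
    using assms(3)
  proof (induction q rule: Q_induct)
    case (mult q q')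
    then show ?case
      using assms(1,2) by (simp add: Q_interchange[of "lbi Q a q" "lbi Q b q" "lbi Q a q'" "lbi Q b q'"])
  qed (simp add: assms(1,2) S.l_distr pure_addl)
  show "rbi Q q (a \<oplus> b) = rbi Q q a \<otimes>\<^bsub>Q\<^esub> rbi Q q b"
    using assms(3)
  proof (induction q rule: Q_induct)
    case (mult q q')
    then show ?case
      using assms(1,2) by (simp add: Q_interchange[of "rbi Q q a" "rbi Q q b" "rbi Q q' a" "rbi Q q' b"])
  qed (simp add: assms(1,2) S.r_distr pure_addr)
qed

section \<open>The action of \<open>T\<close>\<close>

lemma T_ops: "monoid.mult T = act" "one T = \<one> \<boxtimes> \<one>" "zero T = one Q" "add T = monoid.mult Q"
  by (simp_all add: ext_T_def Let_def)

lemma T_iff: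
  "t \<in> carrier T \<longleftrightarrow> t \<in> carrier Q \<and> (\<forall>b\<in>carrier B. lbi Q (f b) t = rbi Q t (f b))"
  by (simp add: ext_T_def Let_def invariants_def)

lemma T_in_Q [simp]: "t \<in> carrier T \<Longrightarrow> t \<in> carrier Q"
  by (simp only: T_iff)

lemma T_commute: "t \<in> carrier T \<Longrightarrow> b \<in> carrier B \<Longrightarrow> lbi Q (f b) t = rbi Q t (f b)"
  by (simp only: T_iff)

lemma T_memI:
  "t \<in> carrier Q \<Longrightarrow> (\<And>b. b \<in> carrier B \<Longrightarrow> lbi Q (f b) t = rbi Q t (f b)) \<Longrightarrow> t \<in> carrier T"
  by (subst T_iff) blast

lemma R_ops: "monoid.mult R = add A" "one R = \<zero>"
  by (simp_all add: ext_R_T_def rmod_of_def)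

lemma R_iff: "r \<in> carrier R \<longleftrightarrow> r \<in> carrier A \<and> (\<forall>b\<in>carrier B. f b \<otimes> r = r \<otimes> f b)"
  by (simp add: ext_R_T_def rmod_of_def ext_centralizer_def invariants_def
      regular_bimod_def bimod_of_def)

lemma R_in_A [simp]: "r \<in> carrier R \<Longrightarrow> r \<in> carrier A"
  by (simp only: R_iff)

lemma R_commute: "r \<in> carrier R \<Longrightarrow> b \<in> carrier B \<Longrightarrow> f b \<otimes> r = r \<otimes> f b"
  by (simp only: R_iff)

lemma R_memI:
  "r \<in> carrier A \<Longrightarrow> (\<And>b. b \<in> carrier B \<Longrightarrow> f b \<otimes> r = r \<otimes> f b) \<Longrightarrow> r \<in> carrier R"
  by (subst R_iff) blast

text \<open>The assignment \<open>a \<boxtimes> b \<mapsto> a t b\<close> is balanced over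
  \<open>B\<close> because \<open>t\<close> commutes with every \<open>f s\<close>, which is the
  condition for lying in \<open>T\<close>.\<close>

lemma act_T:
  assumes t: "t \<in> carrier T"
  shows act_hom: "act t \<in> hom Q Q"
    and act_pure [simp]: "a \<in> carrier A \<Longrightarrow> b \<in> carrier A \<Longrightarrow> act t (a \<boxtimes> b) = rbi Q (lbi Q a t) b"
proof -
  have eq: "act t = tensor_lift Q (\<lambda>a b. rbi Q (lbi Q a t) b)"
    by (simp add: ext_act_def Let_def)
  have bal: "rbi Q (lbi Q (a \<otimes> f s) t) b = rbi Q (lbi Q a t) (f s \<otimes> b)"
    if "a \<in> carrier A" "s \<in> carrier B" "b \<in> carrier A" for a s b
  proof -
    have "rbi Q (lbi Q (a \<otimes> f s) t) b = rbi Q (lbi Q a (lbi Q (f s) t)) b"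
      using that t by (subst lbi_lbi) simp_all
    also have "\<dots> = rbi Q (lbi Q a (rbi Q t (f s))) b"
      using that t by (subst T_commute) simp_all
    also have "\<dots> = rbi Q (rbi Q (lbi Q a t) (f s)) b"
      using that t by (subst lbi_rbi) simp_all
    also have "\<dots> = rbi Q (lbi Q a t) (f s \<otimes> b)"
      using that t by (subst rbi_rbi) simp_all
    finally show ?thesis .
  qed
  show "act t \<in> hom Q Q"
    "a \<in> carrier A \<Longrightarrow> b \<in> carrier A \<Longrightarrow> act t (a \<boxtimes> b) = rbi Q (lbi Q a t) b"
    unfolding eq using t
    by (intro Q_lift Q_comm_group; simp add: bimod_add bal)+
qed

lemma act_closed [simp]: "t \<in> carrier T \<Longrightarrow> q \<in> carrier Q \<Longrightarrow> act t q \<in> carrier Q"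
  using hom_in_carrier[OF act_hom] by auto

lemma act_mult [simp]:
  "t \<in> carrier T \<Longrightarrow> q \<in> carrier Q \<Longrightarrow> q' \<in> carrier Q
    \<Longrightarrow> act t (q \<otimes>\<^bsub>Q\<^esub> q') = act t q \<otimes>\<^bsub>Q\<^esub> act t q'"
  using Group.hom_mult[OF act_hom] by auto

text \<open>\<open>T\<close> acts between the two tensor factors and \<open>A\<close> on their outer
  ends. Thus each \<open>act t\<close> is a bimodule endomorphism, and the outer actions descend to
  the tensor product over \<open>T\<close>.\<close>

lemma act_bimod:
  assumes "t \<in> carrier T" "a \<in> carrier A" "q \<in> carrier Q"
  shows act_lbi: "act t (lbi Q a q) = lbi Q a (act t q)"
    and act_rbi: "act t (rbi Q q a) = rbi Q (act t q) a"
  using assms(3)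
  by (induction q rule: Q_induct; simp add: assms(1,2) lbi_lbi rbi_rbi lbi_rbi)+

text \<open>A bimodule endomorphism such as \<open>act t\<close> preserves the elements that commute
  with \<open>B\<close>. The same argument for \<open>ev r\<close> shows that \<open>T\<close> maps
  \<open>R\<close> to itself.\<close>

lemma T_mult_closed [simp]: "t \<in> carrier T \<Longrightarrow> t' \<in> carrier T \<Longrightarrow> act t t' \<in> carrier T"
  by (rule T_memI) (simp_all add: T_commute flip: act_lbi act_rbi)

lemma T_one_closed [simp]: "\<one> \<boxtimes> \<one> \<in> carrier T"
  using pure_balanced[of \<one> _ \<one>] by (intro T_memI) auto

lemma T_add_closed [simp]: "t \<in> carrier T \<Longrightarrow> t' \<in> carrier T \<Longrightarrow> t \<otimes>\<^bsub>Q\<^esub> t' \<in> carrier T"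
  by (rule T_memI) (simp_all add: T_commute)

lemma T_zero_closed [simp]: "\<one>\<^bsub>Q\<^esub> \<in> carrier T"
  using comm_group_hom(1)[OF Q_comm_group Q_comm_group lbi_hom]
    comm_group_hom(1)[OF Q_comm_group Q_comm_group rbi_hom]
  by (intro T_memI) simp_all

lemma T_inv_closed [simp]: "t \<in> carrier T \<Longrightarrow> inv\<^bsub>Q\<^esub> t \<in> carrier T"
  using comm_group_hom(2)[OF Q_comm_group Q_comm_group lbi_hom]
    comm_group_hom(2)[OF Q_comm_group Q_comm_group rbi_hom]
  by (intro T_memI) (simp_all add: T_commute)

text \<open>The free module \<open>free_rmod T X\<close> is a direct sum of copies of this group,
  and \<open>carrier_sum_group\<close> asks for its group axioms.\<close>

lemma T_comm_group: "comm_group (add_monoid T)"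
proof (rule comm_groupI)
  show "\<exists>y\<in>carrier (add_monoid T). y \<otimes>\<^bsub>add_monoid T\<^esub> x = \<one>\<^bsub>add_monoid T\<^esub>"
    if "x \<in> carrier (add_monoid T)" for x
    using that by (intro bexI[of _ "inv\<^bsub>Q\<^esub> x"]) (simp_all add: T_ops)
qed (simp_all add: T_ops Q.m_ac)

lemma act_add:
  assumes "t \<in> carrier T" "t' \<in> carrier T" "q \<in> carrier Q"
  shows "act (t \<otimes>\<^bsub>Q\<^esub> t') q = act t q \<otimes>\<^bsub>Q\<^esub> act t' q"
  using assms(3)
  by (induction q rule: Q_induct) (simp_all add: assms(1,2) Q_interchange)

text \<open>Since the product of \<open>T\<close> is \<open>act\<close> itself, this is
  associativity of both the product and the action. On \<open>a \<boxtimes> b\<close> both sides are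
  \<open>act t t'\<close> multiplied by \<open>a\<close> and \<open>b\<close> on the
  outside.\<close>

lemma act_act:
  assumes "t \<in> carrier T" "t' \<in> carrier T" "q \<in> carrier Q"
  shows "act (act t t') q = act t (act t' q)"
  using assms(3)
  by (induction q rule: Q_induct) (simp_all add: assms(1,2) act_bimod)

lemma act_one [simp]: "q \<in> carrier Q \<Longrightarrow> act (\<one> \<boxtimes> \<one>) q = q"
  by (induction q rule: Q_induct) simp_all

section \<open>The action of \<open>T\<close> on the centralizer, extended to
  \<open>A \<otimes>\<^sub>B A\<close>\<close>

lemma ev_R:
  assumes r: "r \<in> carrier R"
  shows ev_hom: "ev r \<in> hom Q (add_monoid A)"
    and ev_pure [simp]: "a \<in> carrier A \<Longrightarrow> b \<in> carrier A \<Longrightarrow> ev r (a \<boxtimes> b) = a \<otimes> r \<otimes> b"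
proof -
  have eq: "ev r = tensor_lift (add_monoid A) (\<lambda>a b. a \<otimes> r \<otimes> b)"
    by (simp add: ext_R_T_def rmod_of_def)
  \<comment> \<open>Balancing over \<open>B\<close> is where membership of \<open>r\<close> in the
    centralizer enters.\<close>
  have bal: "a \<otimes> f s \<otimes> r \<otimes> b = a \<otimes> r \<otimes> (f s \<otimes> b)"
    if "a \<in> carrier A" "s \<in> carrier B" "b \<in> carrier A" for a s b
  proof -
    have "a \<otimes> f s \<otimes> r \<otimes> b = a \<otimes> (f s \<otimes> r) \<otimes> b"
      using that r by (simp add: S.m_assoc)
    also have "\<dots> = a \<otimes> (r \<otimes> f s) \<otimes> b"
      using that r by (simp add: R_commute)
    finally show ?thesis
      using that r by (simp add: S.m_assoc)
  qed
  show "ev r \<in> hom Q (add_monoid A)"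
    "a \<in> carrier A \<Longrightarrow> b \<in> carrier A \<Longrightarrow> ev r (a \<boxtimes> b) = a \<otimes> r \<otimes> b"
    unfolding eq using r
    by (intro Q_lift add_comm_group; simp add: S.l_distr S.r_distr bal)+
qed

lemma ev_closed [simp]: "r \<in> carrier R \<Longrightarrow> q \<in> carrier Q \<Longrightarrow> ev r q \<in> carrier A"
  using hom_in_carrier[OF ev_hom] by auto

lemma ev_mult [simp]:
  "r \<in> carrier R \<Longrightarrow> q \<in> carrier Q \<Longrightarrow> q' \<in> carrier Q
    \<Longrightarrow> ev r (q \<otimes>\<^bsub>Q\<^esub> q') = ev r q \<oplus> ev r q'"
  using Group.hom_mult[OF ev_hom] by auto

lemma ev_bimod:
  assumes "r \<in> carrier R" "a \<in> carrier A" "q \<in> carrier Q"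
  shows ev_lbi: "ev r (lbi Q a q) = a \<otimes> ev r q"
    and ev_rbi: "ev r (rbi Q q a) = ev r q \<otimes> a"
  using assms(3)
  by (induction q rule: Q_induct; simp add: assms(1,2) S.m_assoc S.l_distr S.r_distr)+

lemma R_one_closed [simp]: "\<one> \<in> carrier R"
  by (rule R_memI) simp_all

lemma R_zero_closed [simp]: "\<zero> \<in> carrier R"
  by (rule R_memI) simp_all

lemma R_add_closed [simp]: "r \<in> carrier R \<Longrightarrow> r' \<in> carrier R \<Longrightarrow> r \<oplus> r' \<in> carrier R"
  by (rule R_memI) (simp_all add: R_commute S.l_distr S.r_distr)

lemma R_minus_closed [simp]: "r \<in> carrier R \<Longrightarrow> \<ominus> r \<in> carrier R"
  by (rule R_memI) (simp_all add: R_commute S.l_minus S.r_minus)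

lemma R_comm_group: "comm_group R"
proof (rule comm_groupI)
  show "\<exists>y\<in>carrier R. y \<otimes>\<^bsub>R\<^esub> x = \<one>\<^bsub>R\<^esub>" if "x \<in> carrier R" for x
    using that by (intro bexI[of _ "\<ominus> x"]) (simp_all add: R_ops S.l_neg)
qed (simp_all add: R_ops S.a_ac)

lemma ev_R_closed [simp]: "r \<in> carrier R \<Longrightarrow> t \<in> carrier T \<Longrightarrow> ev r t \<in> carrier R"
  by (rule R_memI) (simp_all add: T_commute flip: ev_lbi ev_rbi)

lemma ev_add:
  assumes "r \<in> carrier R" "r' \<in> carrier R" "q \<in> carrier Q"
  shows "ev (r \<oplus> r') q = ev r q \<oplus> ev r' q"
  using assms(3)
  by (induction q rule: Q_induct) (simp_all add: assms(1,2) S.l_distr S.r_distr A_interchange)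

text \<open>On \<open>a \<boxtimes> b\<close> both sides are \<open>a (ev r t) b\<close>, as
  \<open>ev r\<close> is a bimodule map. For \<open>q\<close> in \<open>T\<close> this is
  associativity of the action on \<open>R\<close>; for general \<open>q\<close> it makes
  \<open>ev\<close> balanced over \<open>T\<close>.\<close>

lemma ev_act:
  assumes "r \<in> carrier R" "t \<in> carrier T" "q \<in> carrier Q"
  shows "ev r (act t q) = ev (ev r t) q"
  using assms(3)
  by (induction q rule: Q_induct) (simp_all add: assms(1,2) ev_bimod)

end

lemma comm_group_hom_finprod:
  assumes "comm_group G" "comm_group H" "h \<in> hom G H" "finite S" "\<And>x. x \<in> S \<Longrightarrow> g x \<in> carrier G"
  shows "h (finprod G g S) = finprod H (\<lambda>x. h (g x)) S"
proof -
  interpret G: comm_group G by fact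
  interpret H: comm_group H by fact
  have cl: "h y \<in> carrier H" if "y \<in> carrier G" for y
    using assms(3) that by (rule hom_in_carrier)
  show ?thesis
    using assms(4,5)
  proof (induction S rule: finite_induct)
    case empty
    show ?case using comm_group_hom(1)[OF assms(1-3)] by simp
  next
    case (insert x S)
    then show ?case
      by (simp add: G.finprod_insert H.finprod_insert Pi_def cl hom_mult[OF assms(3)])
  qed
qed

lemma regular_bimod_simps:
  "carrier (regular_bimod A) = carrier A" "monoid.mult (regular_bimod A) = add A"
  "lbi (regular_bimod A) = monoid.mult A" "rbi (regular_bimod A) = monoid.mult A"
  by (simp_all add: regular_bimod_def bimod_of_def)

context ring_extension
begin

section \<open>Separability elements\<close>

text \<open>This is \<open>(A \<otimes>\<^sub>B A)\<^sup>A\<close>. The usual normalization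
  \<open>ev \<one> e = \<one>\<close> is stated separately, so that the set is closed under sums and
  under the action of \<open>T\<close>.\<close>

definition separability_elements :: "('a, 'a) tensor set" where
  "separability_elements = {e \<in> carrier Q. \<forall>a\<in>carrier A. lbi Q a e = rbi Q e a}"

lemma separability_in_Q [simp]: "e \<in> separability_elements \<Longrightarrow> e \<in> carrier Q"
  unfolding separability_elements_def by blast

lemma separability_central:
  "e \<in> separability_elements \<Longrightarrow> a \<in> carrier A \<Longrightarrow> rbi Q e a = lbi Q a e"
  unfolding separability_elements_def by simp

lemma separability_memI:
  "e \<in> carrier Q \<Longrightarrow> (\<And>a. a \<in> carrier A \<Longrightarrow> lbi Q a e = rbi Q e a) \<Longrightarrow> e \<in> separability_elements"
  unfolding separability_elements_def by blast

text \<open>Through this identification the bimodule properties of the multiplication map become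
  instances of \<open>ev_bimod\<close>.\<close>

lemma ext_mult_map_eq:
  assumes "q \<in> carrier Q"
  shows "ext_mult_map A q = ev \<one> q"
proof -
  have hom: "ext_mult_map A \<in> hom Q (add_monoid A)"
    and pure: "\<And>a b. a \<in> carrier A \<Longrightarrow> b \<in> carrier A \<Longrightarrow> ext_mult_map A (a \<boxtimes> b) = a \<otimes> b"
    unfolding ext_mult_map_def
    by (intro Q_lift add_comm_group; simp add: S.l_distr S.r_distr S.m_assoc)+
  show ?thesis
    using assms
    by (induction q rule: Q_induct) (simp_all add: pure Group.hom_mult[OF hom])
qed

text \<open>A bimodule section \<open>s\<close> is determined by \<open>s \<one>\<close>, which is
  central because \<open>a (s \<one>) = s a = (s \<one>) a\<close>. Conversely a central normalized
  \<open>e\<close> gives the section \<open>a \<mapsto> a e\<close>.\<close>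

lemma separable_iff:
  "separable_extension A B f \<longleftrightarrow> (\<exists>e\<in>separability_elements. ev \<one> e = \<one>)"
proof
  assume "separable_extension A B f"
  then obtain s where s: "s \<in> bimod_hom A (regular_bimod A) Q"
    and split: "\<And>a. a \<in> carrier A \<Longrightarrow> ext_mult_map A (s a) = a"
    unfolding separable_extension_def bimod_split_epi_def by (auto simp: regular_bimod_simps)
  have cl: "s a \<in> carrier Q" if "a \<in> carrier A" for a
    using s that unfolding bimod_hom_def hom_def by (auto simp: regular_bimod_simps)
  have "s (a \<otimes> m) = lbi Q a (s m)" "s (m \<otimes> a) = rbi Q (s m) a"
    if "a \<in> carrier A" "m \<in> carrier A" for a m
    using s that unfolding bimod_hom_def mem_Collect_eq regular_bimod_simps by blast+
  from this[of _ \<one>] have "lbi Q a (s \<one>) = rbi Q (s \<one>) a" if "a \<in> carrier A" for a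
    using that by (metis S.l_one S.r_one S.one_closed)
  then have "s \<one> \<in> separability_elements"
    using cl[OF S.one_closed] by (rule separability_memI[rotated])
  moreover have "ev \<one> (s \<one>) = \<one>"
    using cl[OF S.one_closed] split[OF S.one_closed] by (simp add: ext_mult_map_eq)
  ultimately show "\<exists>e\<in>separability_elements. ev \<one> e = \<one>" ..
next
  assume "\<exists>e\<in>separability_elements. ev \<one> e = \<one>"
  then obtain e where e: "e \<in> separability_elements" and one: "ev \<one> e = \<one>"
    by blast
  have "ext_mult_map A \<in> bimod_hom A Q (regular_bimod A)"
    by (auto simp: bimod_hom_def hom_def regular_bimod_simps ext_mult_map_eq ev_bimod)
  moreover have "(\<lambda>a. lbi Q a e) \<in> bimod_hom A (regular_bimod A) Q"
    using e
    by (auto simp: bimod_hom_def hom_def regular_bimod_simps lbi_add lbi_lbi lbi_rbi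
        separability_central)
  moreover have "ext_mult_map A (lbi Q a e) = a" if "a \<in> carrier A" for a
    using that e one by (simp add: ext_mult_map_eq ev_bimod)
  ultimately show "separable_extension A B f"
    unfolding separable_extension_def bimod_split_epi_def regular_bimod_simps
    by (intro conjI bexI[of _ "\<lambda>a. lbi Q a e"] ballI) assumption+
qed

lemma separability_act:
  assumes "e \<in> separability_elements" "t \<in> carrier T"
  shows "act t e \<in> separability_elements"
  using assms by (intro separability_memI) (simp_all add: separability_central flip: act_bimod)

lemma separability_add:
  assumes "e \<in> separability_elements" "e' \<in> separability_elements"
  shows "e \<otimes>\<^bsub>Q\<^esub> e' \<in> separability_elements"
  using assms by (intro separability_memI) (simp_all add: separability_central)

lemma separability_zero: "\<one>\<^bsub>Q\<^esub> \<in> separability_elements"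
  using comm_group_hom(1)[OF Q_comm_group Q_comm_group lbi_hom]
    comm_group_hom(1)[OF Q_comm_group Q_comm_group rbi_hom]
  by (intro separability_memI) simp_all

text \<open>Left multiplication into \<open>e\<close> embeds elements of \<open>R\<close> in
  \<open>T\<close>: \<open>f b\<close> first passes \<open>r\<close>, by centrality of
  \<open>r\<close>, and then \<open>e\<close>.\<close>

lemma separability_T:
  assumes "e \<in> separability_elements" "r \<in> carrier R"
  shows "lbi Q r e \<in> carrier T"
  using assms
  by (intro T_memI) (simp_all add: separability_central lbi_lbi lbi_rbi R_commute)

text \<open>On \<open>a \<boxtimes> b\<close> the left side is \<open>a r e b\<close>, which equals
  \<open>(a r b) e\<close> by centrality of \<open>e\<close>. This identity drives both the
  splitting of \<open>R\<close> and the isomorphism with \<open>A\<close>.\<close>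

lemma act_separability:
  assumes "e \<in> separability_elements" "r \<in> carrier R" "q \<in> carrier Q"
  shows "act (lbi Q r e) q = lbi Q (ev r q) e"
  using assms(3)
  by (induction q rule: Q_induct)
    (simp_all add: assms(1,2) separability_T separability_central lbi_lbi lbi_rbi lbi_add S.m_assoc)

section \<open>The bimodule \<open>R \<otimes>\<^sub>T (A \<otimes>\<^sub>B A)\<close>\<close>

abbreviation W where "W \<equiv> ext_R_tensor A B f"
abbreviation pureW (infixl "\<odot>" 74)
  where "pureW \<equiv> pure_tensor (ext_T A B f) (ext_R_T A B f) (ext_T_tensor A B f)"

sublocale RQ: tensor_factors R "ext_T_tensor A B f" T
proof -
  have "comm_group (ext_T_tensor A B f)"
    by (rule comm_group_cong[OF Q_comm_group]; simp add: ext_T_tensor_def lmod_of_def)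
  then show "tensor_factors R (ext_T_tensor A B f) T"
    by (simp add: tensor_factors_def tensor_factors_axioms_def R_comm_group
        ext_T_tensor_def lmod_of_def)
qed

lemma TQ_simps:
  "carrier (ext_T_tensor A B f) = carrier Q"
  "monoid.mult (ext_T_tensor A B f) = monoid.mult Q"
  "lsmult (ext_T_tensor A B f) = act"
  by (simp_all add: ext_T_tensor_def lmod_of_def)

lemma W_simps:
  "carrier W = carrier RQ.P" "monoid.mult W = monoid.mult RQ.P" "one W = one RQ.P"
  by (simp_all add: ext_R_tensor_def Let_def bimod_of_def)

lemma W_comm_group: "comm_group W"
  by (rule comm_group_cong[OF RQ.tensor_comm_group]) (simp_all add: W_simps)

sublocale W: comm_group W
  by (rule W_comm_group)

lemma W_hom: "hom W G = hom RQ.P G" "hom G W = hom G RQ.P"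
  by (simp_all add: hom_def W_simps)

lemma pureW_closed [simp]: "r \<in> carrier R \<Longrightarrow> q \<in> carrier Q \<Longrightarrow> r \<odot> q \<in> carrier W"
  using RQ.pure_closed by (simp add: TQ_simps W_simps)

lemma pureW_addl:
  "r \<in> carrier R \<Longrightarrow> r' \<in> carrier R \<Longrightarrow> q \<in> carrier Q
    \<Longrightarrow> (r \<oplus> r') \<odot> q = (r \<odot> q) \<otimes>\<^bsub>W\<^esub> (r' \<odot> q)"
  using RQ.pure_addl by (simp add: TQ_simps W_simps R_ops)

lemma pureW_addr:
  "r \<in> carrier R \<Longrightarrow> q \<in> carrier Q \<Longrightarrow> q' \<in> carrier Q
    \<Longrightarrow> r \<odot> (q \<otimes>\<^bsub>Q\<^esub> q') = (r \<odot> q) \<otimes>\<^bsub>W\<^esub> (r \<odot> q')"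
  using RQ.pure_addr by (simp add: TQ_simps W_simps)

lemma pureW_balanced:
  "r \<in> carrier R \<Longrightarrow> t \<in> carrier T \<Longrightarrow> q \<in> carrier Q \<Longrightarrow> ev r t \<odot> q = r \<odot> act t q"
  using RQ.pure_balanced by (simp add: TQ_simps)

lemma W_induct [consumes 1, case_names pure mult]:
  assumes "w \<in> carrier W"
    and "\<And>r q. r \<in> carrier R \<Longrightarrow> q \<in> carrier Q \<Longrightarrow> \<Phi> (r \<odot> q)"
    and "\<And>w w'. w \<in> carrier W \<Longrightarrow> w' \<in> carrier W \<Longrightarrow> \<Phi> w \<Longrightarrow> \<Phi> w' \<Longrightarrow> \<Phi> (w \<otimes>\<^bsub>W\<^esub> w')"
  shows "\<Phi> w"
  using RQ.tensor_induct[of w \<Phi>] assms by (simp add: TQ_simps W_simps)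

lemma W_lift:
  assumes "comm_group G"
    and "\<And>r q. r \<in> carrier R \<Longrightarrow> q \<in> carrier Q \<Longrightarrow> \<phi> r q \<in> carrier G"
    and "\<And>r r' q. r \<in> carrier R \<Longrightarrow> r' \<in> carrier R \<Longrightarrow> q \<in> carrier Q
      \<Longrightarrow> \<phi> (r \<oplus> r') q = \<phi> r q \<otimes>\<^bsub>G\<^esub> \<phi> r' q"
    and "\<And>r q q'. r \<in> carrier R \<Longrightarrow> q \<in> carrier Q \<Longrightarrow> q' \<in> carrier Q
      \<Longrightarrow> \<phi> r (q \<otimes>\<^bsub>Q\<^esub> q') = \<phi> r q \<otimes>\<^bsub>G\<^esub> \<phi> r q'"
    and "\<And>r t q. r \<in> carrier R \<Longrightarrow> t \<in> carrier T \<Longrightarrow> q \<in> carrier Q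
      \<Longrightarrow> \<phi> (ev r t) q = \<phi> r (act t q)"
  shows "tensor_lift G \<phi> \<in> hom W G"
    and "r \<in> carrier R \<Longrightarrow> q \<in> carrier Q \<Longrightarrow> tensor_lift G \<phi> (r \<odot> q) = \<phi> r q"
  using RQ.tensor_lift[OF assms(1), of \<phi>] assms(2-5)
  by (simp_all add: TQ_simps W_hom R_ops)

text \<open>The outer action on the second factor is compatible with balancing over \<open>T\<close>
  because it commutes with every \<open>act t\<close>, by \<open>act_bimod\<close>; likewise on the
  right.\<close>

lemma lbi_W:
  assumes a: "a \<in> carrier A"
  shows lbi_W_hom: "lbi W a \<in> hom W W"
    and lbi_pureW [simp]: "r \<in> carrier R \<Longrightarrow> q \<in> carrier Q \<Longrightarrow> lbi W a (r \<odot> q) = r \<odot> lbi Q a q"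
proof -
  have eq: "lbi W a = tensor_lift RQ.P (\<lambda>r q. r \<odot> lbi Q a q)"
    by (simp add: ext_R_tensor_def Let_def bimod_of_def)
  show "lbi W a \<in> hom W W"
    "r \<in> carrier R \<Longrightarrow> q \<in> carrier Q \<Longrightarrow> lbi W a (r \<odot> q) = r \<odot> lbi Q a q"
    unfolding eq W_hom(2) using a
    by (intro W_lift RQ.tensor_comm_group;
        simp add: pureW_addl pureW_addr pureW_balanced act_bimod flip: W_simps)+
qed

lemma rbi_W:
  assumes a: "a \<in> carrier A"
  shows rbi_W_hom: "(\<lambda>w. rbi W w a) \<in> hom W W"
    and rbi_pureW [simp]: "r \<in> carrier R \<Longrightarrow> q \<in> carrier Q \<Longrightarrow> rbi W (r \<odot> q) a = r \<odot> rbi Q q a"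
proof -
  have eq: "rbi W w a = tensor_lift RQ.P (\<lambda>r q. r \<odot> rbi Q q a) w" for w
    by (simp add: ext_R_tensor_def Let_def bimod_of_def)
  show "(\<lambda>w. rbi W w a) \<in> hom W W"
    "r \<in> carrier R \<Longrightarrow> q \<in> carrier Q \<Longrightarrow> rbi W (r \<odot> q) a = r \<odot> rbi Q q a"
    unfolding eq W_hom(2) using a
    by (intro W_lift RQ.tensor_comm_group;
        simp add: pureW_addl pureW_addr pureW_balanced act_bimod flip: W_simps)+
qed

lemma bimod_W_closed [simp]:
  assumes "a \<in> carrier A" "w \<in> carrier W"
  shows "lbi W a w \<in> carrier W" "rbi W w a \<in> carrier W"
  using hom_in_carrier[OF lbi_W_hom] hom_in_carrier[OF rbi_W_hom] assms by auto

lemma bimod_W_mult [simp]: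
  assumes "a \<in> carrier A" "w \<in> carrier W" "w' \<in> carrier W"
  shows "lbi W a (w \<otimes>\<^bsub>W\<^esub> w') = lbi W a w \<otimes>\<^bsub>W\<^esub> lbi W a w'"
    and "rbi W (w \<otimes>\<^bsub>W\<^esub> w') a = rbi W w a \<otimes>\<^bsub>W\<^esub> rbi W w' a"
  using Group.hom_mult[OF lbi_W_hom] Group.hom_mult[OF rbi_W_hom] assms by auto

lemma free_simps:
  "carrier (free_rmod T X) = {u \<in> X \<rightarrow>\<^sub>E carrier T. finite {x \<in> X. u x \<noteq> \<one>\<^bsub>Q\<^esub>}}"
  "monoid.mult (free_rmod T X) = (\<lambda>u v. \<lambda>x\<in>X. u x \<otimes>\<^bsub>Q\<^esub> v x)"
  "rsmult (free_rmod T X) = (\<lambda>u t. \<lambda>x\<in>X. act (u x) t)"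
proof -
  have "group (add_monoid T)"
    using T_comm_group by (rule comm_group.axioms)
  then show "carrier (free_rmod T X) = {u \<in> X \<rightarrow>\<^sub>E carrier T. finite {x \<in> X. u x \<noteq> \<one>\<^bsub>Q\<^esub>}}"
    by (simp add: free_rmod_def rmod_of_def carrier_sum_group T_ops)
qed (simp_all add: free_rmod_def rmod_of_def T_ops fun_eq_iff)

lemma act_zero [simp]: "q \<in> carrier Q \<Longrightarrow> act \<one>\<^bsub>Q\<^esub> q = \<one>\<^bsub>Q\<^esub>"
  using comm_group_hom(1)[OF T_comm_group Q_comm_group, of "\<lambda>t. act t q"]
  by (simp add: hom_def T_ops act_add Pi_def)

section \<open>Separable extensions\<close>

text \<open>The unit alone generates: \<open>r e\<close> lies in \<open>T\<close>, and
  \<open>ev \<one> (r e) = r (ev \<one> e) = r\<close>.\<close>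

lemma separable_finitely_generated:
  assumes e: "e \<in> separability_elements" and one: "ev \<one> e = \<one>"
  shows "finitely_generated_rmod T R"
proof -
  have "r = finprod R (\<lambda>x. ev x (lbi Q r e)) {\<one>}" if "r \<in> carrier R" for r
    using that e one by (simp add: RQ.M.finprod_insert separability_T ev_bimod)
  moreover have "(\<lambda>x. lbi Q r e) \<in> {\<one>} \<rightarrow> carrier T" if "r \<in> carrier R" for r
    using separability_T[OF e that] by simp
  ultimately have "\<forall>r\<in>carrier R. \<exists>c\<in>{\<one>} \<rightarrow> carrier T. r = finprod R (\<lambda>x. ev x (c x)) {\<one>}"
    by (intro ballI bexI)
  then show ?thesis
    unfolding finitely_generated_rmod_def by (intro exI[of _ "{\<one>}"]) simp
qed

text \<open>
  \<open>R\<close> is the direct summand \<open>e T\<close> of \<open>T\<close>: the map \<open>r \<mapsto> r e\<close> is a section of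
  \<open>t \<mapsto> t\<^sup>1 t\<^sup>2\<close>.
\<close>

lemma separable_projective:
  assumes e: "e \<in> separability_elements" and one: "ev \<one> e = \<one>"
  shows "projective_rmod T R"
proof -
  \<comment> \<open>The free module on \<open>{\<one>}\<close> is a copy of \<open>T\<close>; the
    index \<open>\<one>\<close> merely serves as a point of the element type of \<open>R\<close>,
    from which bases are taken.\<close>
  have "(\<lambda>u. ev \<one> (u \<one>)) \<in> rmod_hom T (free_rmod T {\<one>}) R"
    by (auto simp: rmod_hom_def hom_def free_simps R_ops PiE_iff ev_act)
  \<comment> \<open>Linearity over \<open>T\<close> is \<open>act_separability\<close> for
    \<open>q\<close> in \<open>T\<close>: \<open>r e\<close> times \<open>t\<close> is
    \<open>(ev r t) e\<close>.\<close>
  moreover have "(\<lambda>r. \<lambda>x\<in>{\<one>}. lbi Q r e) \<in> rmod_hom T R (free_rmod T {\<one>})"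
    using e
    by (auto simp: rmod_hom_def hom_def free_simps R_ops PiE_iff separability_T lbi_add
        act_separability fun_eq_iff)
  moreover have "ev \<one> ((\<lambda>x\<in>{\<one>}. lbi Q r e) \<one>) = r" if "r \<in> carrier R" for r
    using that e one by (simp add: ev_bimod)
  ultimately show ?thesis
    unfolding projective_rmod_def by (intro exI[of _ "{\<one>}"] bexI ballI) assumption+
qed

lemma separable_isomorphic:
  assumes e: "e \<in> separability_elements" and one: "ev \<one> e = \<one>"
  shows "bimod_isomorphic A W (regular_bimod A)"
proof -
  \<comment> \<open>The evaluation \<open>r \<odot> q \<mapsto> q\<^sup>1 r q\<^sup>2\<close>,
    balanced over \<open>T\<close> by \<open>ev_act\<close>.\<close>
  define h where "h = tensor_lift (add_monoid A) ev"
  have hom: "h \<in> hom W (add_monoid A)"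
    and pure [simp]: "\<And>r q. r \<in> carrier R \<Longrightarrow> q \<in> carrier Q \<Longrightarrow> h (r \<odot> q) = ev r q"
    unfolding h_def by (intro W_lift add_comm_group; simp add: ev_add ev_act)+
  have mult [simp]: "h (w \<otimes>\<^bsub>W\<^esub> w') = h w \<oplus> h w'" if "w \<in> carrier W" "w' \<in> carrier W" for w w'
    using Group.hom_mult[OF hom that] by simp
  have cl [simp]: "h w \<in> carrier A" if "w \<in> carrier W" for w
    using hom_in_carrier[OF hom that] by simp
  have "h (lbi W a w) = a \<otimes> h w" "h (rbi W w a) = h w \<otimes> a"
    if "a \<in> carrier A" "w \<in> carrier W" for a w
    using that(2)
    by (induction w rule: W_induct; simp add: that(1) ev_bimod S.l_distr S.r_distr)+
  then have "h \<in> bimod_hom A W (regular_bimod A)"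
    by (auto simp: bimod_hom_def hom_def regular_bimod_simps)
  moreover have "bij_betw h (carrier W) (carrier (regular_bimod A))"
  proof (rule bij_betw_byWitness[where f' = "\<lambda>a. \<one> \<odot> lbi Q a e"])
    show "\<forall>w\<in>carrier W. \<one> \<odot> lbi Q (h w) e = w"
    proof
      fix w assume "w \<in> carrier W"
      then show "\<one> \<odot> lbi Q (h w) e = w"
      proof (induction w rule: W_induct)
        case (pure r q)
        \<comment> \<open>\<open>(ev r q) e\<close> is the result of \<open>r e\<close> acting on
          \<open>q\<close>; balancing moves \<open>r e\<close> to the left factor, where it takes
          \<open>\<one>\<close> to \<open>r\<close>.\<close>
        then have "\<one> \<odot> lbi Q (ev r q) e = ev \<one> (lbi Q r e) \<odot> q"
          using e by (simp add: pureW_balanced separability_T act_separability)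
        then show ?case
          using pure e one by (simp add: ev_bimod)
      next
        case (mult w w')
        then show ?case using e by (simp add: lbi_add pureW_addr)
      qed
    qed
    show "\<forall>a\<in>carrier (regular_bimod A). h (\<one> \<odot> lbi Q a e) = a"
      using e one by (simp add: regular_bimod_simps ev_bimod)
  qed (use e in \<open>auto simp: regular_bimod_simps\<close>)
  ultimately show ?thesis
    unfolding bimod_isomorphic_def by (intro bexI)
qed

section \<open>Dual bases\<close>

text \<open>A linear map on a free module is determined by its values on the standard basis
  \<open>\<delta>\<close>; the coordinates are split off one at a time. \<open>S\<close> may exceed
  the support, so that different elements can share an index set.\<close>

lemma rmod_hom_free_decomp:
  fixes X :: "'i set"
  assumes p: "p \<in> rmod_hom T (free_rmod T X) R"
    and \<delta>: "\<And>x. x \<in> X \<Longrightarrow> \<delta> x = (\<lambda>y\<in>X. if y = x then \<one> \<boxtimes> \<one> else \<one>\<^bsub>Q\<^esub>)"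
    and "finite S" "S \<subseteq> X"
    and "u \<in> X \<rightarrow>\<^sub>E carrier T" "\<And>x. x \<in> X - S \<Longrightarrow> u x = \<one>\<^bsub>Q\<^esub>"
  shows "p u = finprod R (\<lambda>x. ev (p (\<delta> x)) (u x)) S"
proof -
  let ?F = "free_rmod T X"
  have pcl: "p v \<in> carrier R" if "v \<in> carrier ?F" for v
    using p that by (auto simp: rmod_hom_def hom_def)
  have pmult: "p (v \<otimes>\<^bsub>?F\<^esub> v') = p v \<oplus> p v'" if "v \<in> carrier ?F" "v' \<in> carrier ?F" for v v'
    using p that by (auto simp: rmod_hom_def hom_def R_ops)
  have psm: "p (rsmult ?F v t) = ev (p v) t" if "v \<in> carrier ?F" "t \<in> carrier T" for v t
    using p that by (auto simp: rmod_hom_def)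
  have fin: "v \<in> carrier ?F"
    if "v \<in> X \<rightarrow>\<^sub>E carrier T" "finite S" "\<And>x. x \<in> X - S \<Longrightarrow> v x = \<one>\<^bsub>Q\<^esub>" for v S
  proof -
    have "{x \<in> X. v x \<noteq> \<one>\<^bsub>Q\<^esub>} \<subseteq> S" using that(3) by blast
    then show ?thesis using that(1,2) by (auto simp: free_simps intro: finite_subset)
  qed
  have \<delta>cl: "\<delta> x \<in> carrier ?F" if "x \<in> X" for x
    by (rule fin[of _ "{x}"]) (auto simp: \<delta> that)
  show ?thesis
    using assms(3-6)
  proof (induction S arbitrary: u rule: finite_induct)
    case empty
    then have u: "u \<in> carrier ?F" by (intro fin[of u "{}"]) auto
    \<comment> \<open>Here \<open>u\<close> vanishes on all of \<open>X\<close>. From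
      \<open>u + u = u\<close> additivity gives \<open>p u = \<zero>\<close> by cancellation in
      \<open>A\<close>.\<close>
    have "u \<otimes>\<^bsub>?F\<^esub> u = u"
      using empty by (auto simp: free_simps fun_eq_iff PiE_iff extensional_def)
    then have "p u \<oplus> p u = p u"
      using pmult[OF u u] by simp
    then have "p u = \<zero>"
      using R_in_A[OF pcl[OF u]] by (simp add: S.add.l_cancel_one)
    then show ?case by (simp add: R_ops)
  next
    case (insert x S)
    \<comment> \<open>\<open>?v\<close> carries the coordinate of \<open>u\<close> at
      \<open>x\<close>, and \<open>?w\<close> is the remainder, supported in
      \<open>S\<close>.\<close>
    let ?v = "rsmult ?F (\<delta> x) (u x)" and ?w = "u(x := \<one>\<^bsub>Q\<^esub>)"
    have x: "x \<in> X"
      using insert by auto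
    have ux: "u y \<in> carrier T" if "y \<in> X" for y
      using insert that by auto
    have w: "?w \<in> X \<rightarrow>\<^sub>E carrier T" "y \<in> X - S \<Longrightarrow> ?w y = \<one>\<^bsub>Q\<^esub>" for y
      using insert by (auto simp: PiE_iff extensional_def)
    have v: "?v \<in> carrier ?F"
      using insert \<delta> x by (intro fin[of _ "{x}"]) (auto simp: free_simps PiE_iff)
    have "u = ?v \<otimes>\<^bsub>?F\<^esub> ?w"
      using insert \<delta> by (auto simp: free_simps fun_eq_iff PiE_iff extensional_def)
    then have "p u = p (?v \<otimes>\<^bsub>?F\<^esub> ?w)"
      by (rule arg_cong)
    also have "\<dots> = p ?v \<oplus> p ?w"
      by (rule pmult[OF v fin[OF w(1) insert.hyps(1) w(2)]])
    also have "p ?v = ev (p (\<delta> x)) (u x)"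
      by (rule psm[OF \<delta>cl[OF x] ux[OF x]])
    also have "p ?w = finprod R (\<lambda>y. ev (p (\<delta> y)) (?w y)) S"
      using insert w by (intro insert.IH) auto
    also have "\<dots> = finprod R (\<lambda>y. ev (p (\<delta> y)) (u y)) S"
      using insert by (intro RQ.M.finprod_cong') (auto intro!: ev_R_closed pcl \<delta>cl ux)
    also have "ev (p (\<delta> x)) (u x) \<oplus> \<dots> = finprod R (\<lambda>y. ev (p (\<delta> y)) (u y)) (insert x S)"
      using insert by (subst RQ.M.finprod_insert) (auto simp: R_ops intro!: ev_R_closed pcl \<delta>cl ux)
    finally show ?case .
  qed
qed

end

text \<open>The dual basis description of projectivity: elements \<open>\<rho> x\<close> of
  \<open>R\<close> with \<open>T\<close>-linear coordinate functionals
  \<open>r \<mapsto> s r x\<close>. The expansion is stated for every finite index set containing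
  the support, so that expansions can be added.\<close>

locale dual_basis = ring_extension A B f
  for A :: "('a, 'x) ring_scheme" (structure) and B :: "('b, 'y) ring_scheme" and f :: "'b \<Rightarrow> 'a" +
  fixes X :: "'i set" and \<rho> :: "'i \<Rightarrow> 'a" and s :: "'a \<Rightarrow> 'i \<Rightarrow> ('a, 'a) tensor"
  assumes basis_closed: "x \<in> X \<Longrightarrow> \<rho> x \<in> carrier R"
    and coord_closed: "r \<in> carrier R \<Longrightarrow> x \<in> X \<Longrightarrow> s r x \<in> carrier T"
    and coord_add: "r \<in> carrier R \<Longrightarrow> r' \<in> carrier R \<Longrightarrow> x \<in> X
      \<Longrightarrow> s (r \<oplus> r') x = s r x \<otimes>\<^bsub>Q\<^esub> s r' x"
    and coord_ev: "r \<in> carrier R \<Longrightarrow> t \<in> carrier T \<Longrightarrow> x \<in> X \<Longrightarrow> s (ev r t) x = act (s r x) t"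
    and coord_finite: "r \<in> carrier R \<Longrightarrow> finite {x \<in> X. s r x \<noteq> \<one>\<^bsub>Q\<^esub>}"
    and expansion: "r \<in> carrier R \<Longrightarrow> finite S \<Longrightarrow> {x \<in> X. s r x \<noteq> \<one>\<^bsub>Q\<^esub>} \<subseteq> S \<Longrightarrow> S \<subseteq> X
      \<Longrightarrow> r = finprod R (\<lambda>x. ev (\<rho> x) (s r x)) S"

context ring_extension
begin

text \<open>Let \<open>p\<close> and \<open>s\<close> exhibit \<open>R\<close> as a direct summand
  of a free module. The elements \<open>\<rho> x\<close> are the images under \<open>p\<close> of
  the standard basis, the coordinates are the components of \<open>s\<close>, and applying
  \<open>p\<close> to \<open>s r\<close> recovers \<open>r\<close>.\<close>

lemma projective_dual_basis:
  assumes "projective_rmod T R"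
  shows "\<exists>(X :: 'a set) \<rho> s. dual_basis A B f X \<rho> s"
proof -
  obtain X :: "'a set" and p s where p: "p \<in> rmod_hom T (free_rmod T X) R"
    and s: "s \<in> rmod_hom T R (free_rmod T X)" and ps: "\<And>r. r \<in> carrier R \<Longrightarrow> p (s r) = r"
    using assms unfolding projective_rmod_def by auto
  define \<delta> where "\<delta> x = (\<lambda>y\<in>X. if y = x then \<one> \<boxtimes> \<one> else \<one>\<^bsub>Q\<^esub>)" for x
  have scl: "s r \<in> carrier (free_rmod T X)" if "r \<in> carrier R" for r
    using s that by (auto simp: rmod_hom_def hom_def)
  have "dual_basis A B f X (\<lambda>x. p (\<delta> x)) s"
  proof
    fix x assume "x \<in> X"
    have "{y \<in> X. \<delta> x y \<noteq> \<one>\<^bsub>Q\<^esub>} \<subseteq> {x}" by (auto simp: \<delta>_def)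
    then have "\<delta> x \<in> carrier (free_rmod T X)"
      by (auto simp: free_simps \<delta>_def intro: finite_subset)
    then show "p (\<delta> x) \<in> carrier R"
      using p by (auto simp: rmod_hom_def hom_def)
  next
    fix r x assume "r \<in> carrier R" "x \<in> X"
    then show "s r x \<in> carrier T" using scl[of r] by (auto simp: free_simps)
  next
    fix r r' x assume "r \<in> carrier R" "r' \<in> carrier R" "x \<in> X"
    moreover from this have "s (r \<oplus> r') = s r \<otimes>\<^bsub>free_rmod T X\<^esub> s r'"
      using s by (auto simp: rmod_hom_def hom_def R_ops)
    ultimately show "s (r \<oplus> r') x = s r x \<otimes>\<^bsub>Q\<^esub> s r' x" by (simp add: free_simps)
  next
    fix r t x assume "r \<in> carrier R" "t \<in> carrier T" "x \<in> X"
    moreover from this have "s (ev r t) = rsmult (free_rmod T X) (s r) t"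
      using s by (auto simp: rmod_hom_def)
    ultimately show "s (ev r t) x = act (s r x) t" by (simp add: free_simps)
  next
    fix r assume "r \<in> carrier R"
    then show "finite {x \<in> X. s r x \<noteq> \<one>\<^bsub>Q\<^esub>}" using scl[of r] by (auto simp: free_simps)
  next
    fix r S assume r: "r \<in> carrier R"
      and S: "finite S" "{x \<in> X. s r x \<noteq> \<one>\<^bsub>Q\<^esub>} \<subseteq> S" "S \<subseteq> X"
    have "p (s r) = finprod R (\<lambda>x. ev (p (\<delta> x)) (s r x)) S"
      using S scl[OF r] by (intro rmod_hom_free_decomp[OF p \<delta>_def]) (auto simp: free_simps)
    then show "r = finprod R (\<lambda>x. ev (p (\<delta> x)) (s r x)) S"
      using ps[OF r] by simp
  qed
  then show ?thesis by blast
qed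

text \<open>
  Every bimodule map \<open>R \<otimes>\<^sub>T (A \<otimes>\<^sub>B A) \<rightarrow> A\<close> restricts on \<open>r \<otimes> (A \<otimes>\<^sub>B A)\<close> to
  \<open>a \<otimes> a' \<mapsto> a c a'\<close> for some \<open>c\<close> in \<open>R\<close>, which is the multiplication map after the action of
  \<open>c \<otimes> 1\<close>.
\<close>

lemma bimod_hom_pure_separability:
  assumes h: "h \<in> bimod_hom A W (regular_bimod A)" and r: "r \<in> carrier R"
    and e: "e \<in> separability_elements"
  shows "\<exists>e'\<in>separability_elements. h (r \<odot> e) = ev \<one> e'"
proof -
  have h_mult: "h (w \<otimes>\<^bsub>W\<^esub> w') = h w \<oplus> h w'" if "w \<in> carrier W" "w' \<in> carrier W" for w w'
    using h that by (auto simp: bimod_hom_def hom_def regular_bimod_simps)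
  have cl: "h w \<in> carrier A" if "w \<in> carrier W" for w
    using h that by (auto simp: bimod_hom_def hom_def regular_bimod_simps)
  have lbi: "h (lbi W a w) = a \<otimes> h w" and rbi: "h (rbi W w a) = h w \<otimes> a"
    if "a \<in> carrier A" "w \<in> carrier W" for a w
    using h that by (simp_all add: bimod_hom_def regular_bimod_simps)
  define c where "c = h (r \<odot> (\<one> \<boxtimes> \<one>))"
  \<comment> \<open>In \<open>A \<otimes>\<^sub>B A\<close> the elements
    \<open>f b \<boxtimes> \<one>\<close> and \<open>\<one> \<boxtimes> f b\<close> coincide, so the
    bimodule map \<open>h\<close> forces \<open>c\<close> to commute with
    \<open>f b\<close>.\<close>
  have c: "c \<in> carrier R"
  proof (rule R_memI)
    show "c \<in> carrier A" unfolding c_def using r by (intro cl) simp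
    fix b assume b: "b \<in> carrier B"
    have "f b \<otimes> c = h (r \<odot> (f b \<boxtimes> \<one>))"
      using lbi[of "f b" "r \<odot> (\<one> \<boxtimes> \<one>)"] b r by (simp add: c_def)
    also have "f b \<boxtimes> \<one> = \<one> \<boxtimes> f b"
      using pure_balanced[of \<one> b \<one>] b by simp
    also have "h (r \<odot> (\<one> \<boxtimes> f b)) = c \<otimes> f b"
      using rbi[of "f b" "r \<odot> (\<one> \<boxtimes> \<one>)"] b r by (simp add: c_def)
    finally show "f b \<otimes> c = c \<otimes> f b" .
  qed
  have "h (r \<odot> q) = ev c q" if "q \<in> carrier Q" for q
    using that
  proof (induction q rule: Q_induct)
    case (pure a b)
    have "r \<odot> (a \<boxtimes> b) = rbi W (lbi W a (r \<odot> (\<one> \<boxtimes> \<one>))) b"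
      using pure r by simp
    then show ?case
      using pure r c by (simp only: rbi lbi bimod_W_closed pureW_closed pure_closed S.one_closed
          ev_pure flip: c_def)
  next
    case (mult q q')
    then show ?case using r c by (simp add: pureW_addr h_mult)
  qed
  then have "h (r \<odot> e) = ev c e"
    using e by simp
  moreover have "c \<boxtimes> \<one> \<in> carrier T"
  proof (rule T_memI)
    fix b assume b: "b \<in> carrier B"
    then show "lbi Q (f b) (c \<boxtimes> \<one>) = rbi Q (c \<boxtimes> \<one>) (f b)"
      using c pure_balanced[of c b \<one>] by (simp add: R_commute)
  qed (use c in simp)
  \<comment> \<open>This is \<open>ev_act\<close> at \<open>r = \<one>\<close>, since
    \<open>ev \<one> (c \<boxtimes> \<one>) = c\<close>. The action of
    \<open>c \<boxtimes> \<one>\<close> keeps \<open>e\<close> central, so it yields the required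
    witness.\<close>
  moreover from this have "ev \<one> (act (c \<boxtimes> \<one>) e) = ev c e"
    using c e by (simp add: ev_act)
  ultimately show ?thesis
    using separability_act[OF e] by (intro bexI[of _ "act (c \<boxtimes> \<one>) e"]) simp_all
qed

end

section \<open>Coordinates of elements of
  \<open>R \<otimes>\<^sub>T (A \<otimes>\<^sub>B A)\<close>\<close>

context dual_basis
begin

text \<open>This is the functional \<open>r \<mapsto> s r x\<close> tensored with the identity,
  followed by the identification of \<open>T \<otimes>\<^sub>T (A \<otimes>\<^sub>B A)\<close> with
  \<open>A \<otimes>\<^sub>B A\<close>.\<close>

definition coord_map where "coord_map x = tensor_lift Q (\<lambda>r q. act (s r x) q)"

lemma coord_map_W:
  assumes "x \<in> X"
  shows coord_map_hom: "coord_map x \<in> hom W Q"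
    and coord_map_pure: "r \<in> carrier R \<Longrightarrow> q \<in> carrier Q \<Longrightarrow> coord_map x (r \<odot> q) = act (s r x) q"
  unfolding coord_map_def using assms
  by (intro W_lift Q_comm_group; simp add: coord_closed coord_add coord_ev act_add act_act)+

lemma coord_map_closed: "x \<in> X \<Longrightarrow> w \<in> carrier W \<Longrightarrow> coord_map x w \<in> carrier Q"
  using hom_in_carrier[OF coord_map_hom] .

lemma coord_map_mult:
  "x \<in> X \<Longrightarrow> w \<in> carrier W \<Longrightarrow> w' \<in> carrier W \<Longrightarrow> coord_map x (w \<otimes>\<^bsub>W\<^esub> w') = coord_map x w \<otimes>\<^bsub>Q\<^esub> coord_map x w'"
  using Group.hom_mult[OF coord_map_hom] .

lemma coord_map_bimod:
  assumes "x \<in> X" "a \<in> carrier A" "w \<in> carrier W"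
  shows coord_map_lbi: "coord_map x (lbi W a w) = lbi Q a (coord_map x w)"
    and coord_map_rbi: "coord_map x (rbi W w a) = rbi Q (coord_map x w) a"
  using assms(3)
  by (induction w rule: W_induct;
      simp add: assms(1,2) coord_map_pure coord_map_mult coord_map_closed coord_closed act_bimod)+

text \<open>Bimodule maps preserve central elements, so a central \<open>z\<close> has all its
  coordinates in \<open>(A \<otimes>\<^sub>B A)\<^sup>A\<close>.\<close>

lemma coord_map_separability:
  assumes x: "x \<in> X" and z: "z \<in> carrier W"
    and central: "\<And>a. a \<in> carrier A \<Longrightarrow> lbi W a z = rbi W z a"
  shows "coord_map x z \<in> separability_elements"
proof (rule separability_memI)
  fix a assume a: "a \<in> carrier A"
  have "lbi Q a (coord_map x z) = coord_map x (lbi W a z)"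
    by (rule coord_map_lbi[OF x a z, symmetric])
  also have "\<dots> = rbi Q (coord_map x z) a"
    by (subst central[OF a]) (rule coord_map_rbi[OF x a z])
  finally show "lbi Q a (coord_map x z) = rbi Q (coord_map x z) a" .
qed (rule coord_map_closed[OF x z])

text \<open>Expand \<open>r\<close> in the dual basis, tensor with \<open>q\<close>, and move the
  coefficients \<open>s r x\<close> across the tensor sign.\<close>

lemma expansion_pure:
  assumes r: "r \<in> carrier R" and q: "q \<in> carrier Q"
    and S: "finite S" "{x \<in> X. s r x \<noteq> \<one>\<^bsub>Q\<^esub>} \<subseteq> S" "S \<subseteq> X"
  shows "r \<odot> q = finprod W (\<lambda>x. \<rho> x \<odot> coord_map x (r \<odot> q)) S"
proof -
  have X: "x \<in> X" if "x \<in> S" for x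
    using that S(3) by blast
  have "(\<lambda>r. r \<odot> q) \<in> hom R W"
    using q by (simp add: hom_def R_ops pureW_addl)
  then have "finprod R (\<lambda>x. ev (\<rho> x) (s r x)) S \<odot> q = finprod W (\<lambda>x. ev (\<rho> x) (s r x) \<odot> q) S"
    by (rule comm_group_hom_finprod[OF R_comm_group W_comm_group _ S(1)])
      (simp add: X r basis_closed coord_closed)
  also have "\<dots> = finprod W (\<lambda>x. \<rho> x \<odot> coord_map x (r \<odot> q)) S"
    by (intro W.finprod_cong' refl)
      (simp_all add: X r q basis_closed coord_closed pureW_balanced coord_map_pure)
  finally show ?thesis
    \<comment> \<open>Only the first \<open>r\<close> is expanded; the occurrences inside the
      coordinates stay.\<close>
    by (subst (1) expansion[OF r S])
qed

text \<open>Asking for the expansion over every finite index set beyond some \<open>F\<close> makes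
  the claim stable under sums: for \<open>w\<close> and \<open>w'\<close> the union of the two sets
  works.\<close>

lemma expansion_W:
  assumes "w \<in> carrier W"
  shows "\<exists>F. finite F \<and> F \<subseteq> X \<and>
    (\<forall>S. finite S \<longrightarrow> F \<subseteq> S \<longrightarrow> S \<subseteq> X \<longrightarrow> w = finprod W (\<lambda>x. \<rho> x \<odot> coord_map x w) S)"
  using assms
proof (induction w rule: W_induct)
  case (pure r q)
  show ?case
    using coord_finite[OF pure(1)] expansion_pure[OF pure]
    by (intro exI[of _ "{x \<in> X. s r x \<noteq> \<one>\<^bsub>Q\<^esub>}"] conjI allI impI) auto
next
  case (mult w w')
  obtain F where F: "finite F" "F \<subseteq> X"
    "\<And>S. finite S \<Longrightarrow> F \<subseteq> S \<Longrightarrow> S \<subseteq> X \<Longrightarrow> w = finprod W (\<lambda>x. \<rho> x \<odot> coord_map x w) S"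
    using mult.IH(1) by blast
  obtain F' where F': "finite F'" "F' \<subseteq> X"
    "\<And>S. finite S \<Longrightarrow> F' \<subseteq> S \<Longrightarrow> S \<subseteq> X \<Longrightarrow> w' = finprod W (\<lambda>x. \<rho> x \<odot> coord_map x w') S"
    using mult.IH(2) by blast
  have "w \<otimes>\<^bsub>W\<^esub> w' = finprod W (\<lambda>x. \<rho> x \<odot> coord_map x (w \<otimes>\<^bsub>W\<^esub> w')) S"
    if S: "finite S" "F \<union> F' \<subseteq> S" "S \<subseteq> X" for S
  proof -
    have X: "x \<in> X" if "x \<in> S" for x
      using that S(3) by blast
    have "finprod W (\<lambda>x. \<rho> x \<odot> coord_map x (w \<otimes>\<^bsub>W\<^esub> w')) S
        = finprod W (\<lambda>x. (\<rho> x \<odot> coord_map x w) \<otimes>\<^bsub>W\<^esub> (\<rho> x \<odot> coord_map x w')) S"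
      by (intro W.finprod_cong' refl)
        (simp_all add: X mult.hyps basis_closed coord_map_mult coord_map_closed pureW_addr)
    also have "\<dots> = finprod W (\<lambda>x. \<rho> x \<odot> coord_map x w) S \<otimes>\<^bsub>W\<^esub> finprod W (\<lambda>x. \<rho> x \<odot> coord_map x w') S"
      by (intro W.finprod_multf) (simp_all add: X mult.hyps basis_closed coord_map_closed)
    also have "\<dots> = w \<otimes>\<^bsub>W\<^esub> w'"
      using F(3)[of S] F'(3)[of S] S by simp
    finally show ?thesis by (rule sym)
  qed
  then show ?case
    using F(1,2) F'(1,2) by (intro exI[of _ "F \<union> F'"] conjI allI impI) auto
qed

lemma isomorphic_separable:
  assumes "bimod_isomorphic A W (regular_bimod A)"
  shows "\<exists>e\<in>separability_elements. ev \<one> e = \<one>"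
proof -
  obtain h where h: "h \<in> bimod_hom A W (regular_bimod A)"
    and bij: "bij_betw h (carrier W) (carrier A)"
    using assms unfolding bimod_isomorphic_def regular_bimod_simps by blast
  have hom: "h \<in> hom W (add_monoid A)"
    using h by (simp add: bimod_hom_def hom_def regular_bimod_simps)
  have h_lbi: "h (lbi W a w) = a \<otimes> h w" and h_rbi: "h (rbi W w a) = h w \<otimes> a"
    if "a \<in> carrier A" "w \<in> carrier W" for a w
    using h that by (simp_all add: bimod_hom_def regular_bimod_simps)
  have "\<one> \<in> h ` carrier W"
    unfolding bij_betw_imp_surj_on[OF bij] by simp
  then obtain z where z: "z \<in> carrier W" "h z = \<one>"
    by auto
  \<comment> \<open>\<open>h\<close> sends both sides to \<open>a\<close>, and \<open>h\<close> is
    injective.\<close>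
  have "lbi W a z = rbi W z a" if a: "a \<in> carrier A" for a
    by (rule inj_onD[OF bij_betw_imp_inj_on[OF bij]]) (simp_all add: a z h_lbi h_rbi)
  then have central: "coord_map x z \<in> separability_elements" if "x \<in> X" for x
    by (rule coord_map_separability[OF that z(1)])
  obtain S where S: "finite S" "S \<subseteq> X"
    and S': "\<forall>S'. finite S' \<longrightarrow> S \<subseteq> S' \<longrightarrow> S' \<subseteq> X
      \<longrightarrow> z = finprod W (\<lambda>x. \<rho> x \<odot> coord_map x z) S'"
    using expansion_W[OF z(1)] by (elim exE conjE)
  have z_sum: "z = finprod W (\<lambda>x. \<rho> x \<odot> coord_map x z) S"
    by (rule S'[rule_format, OF S(1) subset_refl S(2)])
  \<comment> \<open>The summands keep the full \<open>z\<close> while the index set is built up.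
    Each of them maps under \<open>h\<close> to the value of \<open>ev \<one>\<close> at a central
    element, and such values are closed under addition.\<close>
  have "\<exists>e\<in>separability_elements. h (finprod W (\<lambda>x. \<rho> x \<odot> coord_map x z) S) = ev \<one> e"
    using S
  proof (induction S rule: finite_induct)
    case empty
    have "h \<one>\<^bsub>W\<^esub> = \<zero>" "ev \<one> \<one>\<^bsub>Q\<^esub> = \<zero>"
      using comm_group_hom(1)[OF W_comm_group add_comm_group hom]
        comm_group_hom(1)[OF Q_comm_group add_comm_group ev_hom[OF R_one_closed]] by simp_all
    then show ?case
      using separability_zero by (intro bexI[of _ "\<one>\<^bsub>Q\<^esub>"]) simp_all
  next
    case (insert x S)
    have x: "x \<in> X" and SX: "S \<subseteq> X"
      using insert.prems by auto
    obtain e where e: "e \<in> separability_elements"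
        "h (finprod W (\<lambda>x. \<rho> x \<odot> coord_map x z) S) = ev \<one> e"
      using insert.IH[OF SX] by blast
    obtain e' where e': "e' \<in> separability_elements" "h (\<rho> x \<odot> coord_map x z) = ev \<one> e'"
      using bimod_hom_pure_separability[OF h basis_closed[OF x] central[OF x]] by blast
    have cl: "\<rho> y \<odot> coord_map y z \<in> carrier W" if "y \<in> X" for y
      using that z by (intro pureW_closed basis_closed coord_map_closed)
    have cl': "(\<lambda>y. \<rho> y \<odot> coord_map y z) \<in> S \<rightarrow> carrier W"
      using cl SX by blast
    have "finprod W (\<lambda>x. \<rho> x \<odot> coord_map x z) (insert x S)
        = (\<rho> x \<odot> coord_map x z) \<otimes>\<^bsub>W\<^esub> finprod W (\<lambda>x. \<rho> x \<odot> coord_map x z) S"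
      by (rule W.finprod_insert[OF insert.hyps cl' cl[OF x]])
    then have "h (finprod W (\<lambda>x. \<rho> x \<odot> coord_map x z) (insert x S)) = ev \<one> e' \<oplus> ev \<one> e"
      using Group.hom_mult[OF hom cl[OF x] W.finprod_closed[OF cl']] e e' by simp
    then show ?case
      using separability_add[OF e'(1) e(1)] e(1) e'(1) by (intro bexI[of _ "e' \<otimes>\<^bsub>Q\<^esub> e"]) simp_all
  qed
  then show ?thesis
    unfolding z_sum[symmetric] z(2) by (simp only: eq_commute[of \<one>])
qed

end

section \<open>Separability in terms of \<open>R\<close> and
  \<open>R \<otimes>\<^sub>T (A \<otimes>\<^sub>B A)\<close>\<close>

theorem (in ring_extension) separable_extension_iff:
  "separable_extension A B f \<longleftrightarrow>
    finitely_generated_rmod T R \<and> projective_rmod T R \<and> bimod_isomorphic A W (regular_bimod A)"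
proof
  assume "separable_extension A B f"
  then obtain e where "e \<in> separability_elements" "ev \<one> e = \<one>"
    unfolding separable_iff by (elim bexE)
  then show "finitely_generated_rmod T R \<and> projective_rmod T R \<and>
      bimod_isomorphic A W (regular_bimod A)"
    by (intro conjI separable_finitely_generated separable_projective separable_isomorphic)
next
  assume asm: "finitely_generated_rmod T R \<and> projective_rmod T R \<and>
    bimod_isomorphic A W (regular_bimod A)"
  then obtain X :: "'a set" and \<rho> s where "dual_basis A B f X \<rho> s"
    using projective_dual_basis by (elim conjE exE) blast
  then show "separable_extension A B f"
    unfolding separable_iff using asm by (intro dual_basis.isomorphic_separable) auto
qed

theorem theorem4p1:
  fixes A :: "('a, 'x) ring_scheme" and B :: "('b, 'y) ring_scheme" and f :: "'b \<Rightarrow> 'a"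
  assumes "ring_hom_ring B A f"
  shows "separable_extension A B f \<longleftrightarrow>
    finitely_generated_rmod (ext_T A B f) (ext_R_T A B f) \<and>
    projective_rmod (ext_T A B f) (ext_R_T A B f) \<and>
    bimod_isomorphic A (ext_R_tensor A B f) (regular_bimod A)"
  using assms by (intro ring_extension.separable_extension_iff) (simp add: ring_extension_def)

end
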